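(* Let $\alpha,\beta\in\mathbb C^n$ satisfy $\Re\alpha_j+\Re\beta_j>-1$ and $\alpha_j,\beta_j\notin\{-1,-2,\ldots\}$ for all $1\le j\le n$. Assume $u\in Csh_{\alpha,\beta}(\mathbb D^n)$, $1\le k<n$ and $\zeta_j\in\mathbb T$ for $k<j\le n$. Set $\alpha'=(\alpha_1,\ldots,\alpha_k)$, $\beta'=(\beta_1,\ldots,\beta_k)$. Then the function $$u_{\zeta_{k+1},\ldots,\zeta_n}(z_1,\ldots,z_k)=u(z_1,\ldots,z_k,\zeta_{k+1},\ldots,\zeta_n)$$ belongs to the space $Csh_{\alpha',\beta'}(\mathbb D^k)$.
   Context: $\mathbb D$ is the open unit disc and $\mathbb T$ the unit circle. For complex $\alpha_j,\beta_j$, $$L_{\alpha_j,\beta_j}=(1-|z_j|^2)\frac{\partial^2}{\partial z_j\partial\overline{z_j}}+\alpha_jz_j\frac{\partial}{\partial z_j}+\beta_j\overline{z_j}\frac{\partial}{\partial\overline{z_j}}-\alpha_j\beta_j .$$ For $l\ge1$ and $a,b\in\mathbb C^l$, $sh_{a,b}(\mathbb D^l)$ is the space of complex-valued $u\in C^2(\mathbb D^l)$ with $L_{a_j,b_j}u=0$ on $\mathbb D^l$ for all $1\le j\le l$, and $Csh_{a,b}(\mathbb D^l)$ is the set of $u\in C(\overline{\mathbb D^l})$ with $u|_{\mathbb D^l}\in sh_{a,b}(\mathbb D^l)$. *)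

theory Defs
  imports "HOL-Analysis.Analysis"
begin

text \<open>A point of \<open>\<complex>\<^sup>l\<close> is an extensional function on \<open>{1..l}\<close>. The topology on the type
  \<^typ>\<open>nat \<Rightarrow> complex\<close> is the product topology; on the functions that are extensional on
  \<open>{1..l}\<close> it induces the Euclidean topology of \<open>\<complex>\<^sup>l\<close>. A function on the (closed) polydisc is
  represented by a function on the whole type whose values elsewhere are irrelevant.\<close>

definition polydisc :: "nat \<Rightarrow> (nat \<Rightarrow> complex) set"
  where "polydisc l = ({1..l} \<rightarrow>\<^sub>E ball 0 1)"

definition closed_polydisc :: "nat \<Rightarrow> (nat \<Rightarrow> complex) set"
  where "closed_polydisc l = ({1..l} \<rightarrow>\<^sub>E cball 0 1)"

text \<open>For \<open>z\<^sub>j = x\<^sub>j + \<i> y\<^sub>j\<close>, the direction \<open>v = 1\<close> gives the partial derivative with respect to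
  \<open>x\<^sub>j\<close>, and \<open>v = \<i>\<close> the one with respect to \<open>y\<^sub>j\<close>.\<close>

definition slice ::
    "complex \<Rightarrow> nat \<Rightarrow> ((nat \<Rightarrow> complex) \<Rightarrow> complex) \<Rightarrow> (nat \<Rightarrow> complex) \<Rightarrow> real \<Rightarrow> complex"
  where "slice v j u z = (\<lambda>t. u (z(j := z j + of_real t * v)))"

definition partial ::
    "complex \<Rightarrow> nat \<Rightarrow> ((nat \<Rightarrow> complex) \<Rightarrow> complex) \<Rightarrow> (nat \<Rightarrow> complex) \<Rightarrow> complex"
  where "partial v j u z = vector_derivative (slice v j u z) (at 0)"

text \<open>\<open>C_polydisc m l u\<close> says that \<open>u\<close> is of class \<open>C\<^sup>m\<close> on the open polydisc in the real sense: all
  iterated partial derivatives of order at most \<open>m\<close> in the variables \<open>x\<^sub>j, y\<^sub>j\<close> exist and are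
  continuous.\<close>

primrec C_polydisc :: "nat \<Rightarrow> nat \<Rightarrow> ((nat \<Rightarrow> complex) \<Rightarrow> complex) \<Rightarrow> bool"
  where
    "C_polydisc 0 l u \<longleftrightarrow> continuous_on (polydisc l) u"
  | "C_polydisc (Suc m) l u \<longleftrightarrow> continuous_on (polydisc l) u \<and>
       (\<forall>j\<in>{1..l}. \<forall>v\<in>{1, \<i>}.
          (\<forall>z\<in>polydisc l. slice v j u z differentiable at 0) \<and> C_polydisc m l (partial v j u))"

definition dz :: "nat \<Rightarrow> ((nat \<Rightarrow> complex) \<Rightarrow> complex) \<Rightarrow> (nat \<Rightarrow> complex) \<Rightarrow> complex"
  where "dz j u z = (partial 1 j u z - \<i> * partial \<i> j u z) / 2"

definition dzbar :: "nat \<Rightarrow> ((nat \<Rightarrow> complex) \<Rightarrow> complex) \<Rightarrow> (nat \<Rightarrow> complex) \<Rightarrow> complex"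
  where "dzbar j u z = (partial 1 j u z + \<i> * partial \<i> j u z) / 2"

definition L_op ::
    "complex \<Rightarrow> complex \<Rightarrow> nat \<Rightarrow> ((nat \<Rightarrow> complex) \<Rightarrow> complex) \<Rightarrow> (nat \<Rightarrow> complex) \<Rightarrow> complex"
  where "L_op a b j u z =
    (1 - of_real ((cmod (z j))\<^sup>2)) * dz j (dzbar j u) z
      + a * z j * dz j u z + b * cnj (z j) * dzbar j u z - a * b * u z"

definition sh :: "nat \<Rightarrow> (nat \<Rightarrow> complex) \<Rightarrow> (nat \<Rightarrow> complex) \<Rightarrow> ((nat \<Rightarrow> complex) \<Rightarrow> complex) set"
  where "sh l a b =
    {u. C_polydisc 2 l u \<and> (\<forall>j\<in>{1..l}. \<forall>z\<in>polydisc l. L_op (a j) (b j) j u z = 0)}"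

definition Csh :: "nat \<Rightarrow> (nat \<Rightarrow> complex) \<Rightarrow> (nat \<Rightarrow> complex) \<Rightarrow> ((nat \<Rightarrow> complex) \<Rightarrow> complex) set"
  where "Csh l a b = {u. continuous_on (closed_polydisc l) u \<and> u \<in> sh l a b}"

end

theory Submission imports Defs begin

text \<open>
  Approach the boundary values from inside: for \<open>0 \<le> t < 1\<close> the function
  \<open>u(z\<^sub>1, \<dots>, z\<^sub>k, t \<zeta>\<^sub>k\<^sub>+\<^sub>1, \<dots>, t \<zeta>\<^sub>n)\<close> has its frozen variables in the open disc, so it satisfies the \<open>k\<close>
  remaining equations (\<open>sh_append_coords\<close>), and for \<open>t \<rightarrow> 1\<close> it converges to the function of the theorem
  uniformly on the closed polydisc (\<open>radial_uniform_limit\<close>). The theorem therefore follows once the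
  solution space is closed under uniform limits (\<open>sh_uniform_limit\<close>), which is a consequence of interior
  estimates: on compact subsets of the polydisc the derivatives of order at most two of a solution are
  bounded by a constant times its supremum. Applied to differences of members of a sequence, they make
  the derivatives converge.

  The estimates are first proved in one variable and at the centre of the disc. The equation is
  invariant under rotations, so the Fourier coefficient of index \<open>m\<close> of a solution on the circle of
  radius \<open>r\<close> satisfies, as a function of \<open>r\<close>, an ordinary differential equation with a regular singular
  point at \<open>0\<close>. Its solutions of size \<open>o(r\<^sup>m)\<close> vanish near \<open>0\<close> (\<open>singular_system_unique\<close>). For \<open>m = 1, 2\<close> the
  leading term of the coefficient is \<open>f\<^sub>z(0) r\<close> or \<open>f\<^sub>z\<^sub>z(0) r\<^sup>2 / 2\<close>. Hence it is this derivative times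
  one function of \<open>r\<close> that is common to all solutions, and dividing by the value of that function on a
  fixed circle bounds the derivative by the supremum of \<open>f\<close> (\<open>center_coefficient_bound\<close>). Conjugation gives
  the derivatives in \<open>z\<^sup>*\<close>, and the equation itself gives the mixed derivative.

  The automorphism of the disc that takes \<open>0\<close> to \<open>c\<close>, together with the weight
  \<open>(1 + c\<^sup>* w)\<^sup>\<beta> (1 + c w\<^sup>*)\<^sup>\<alpha>\<close>, maps solutions to solutions (\<open>solves_L_moebius\<close>) and carries the estimate from
  the centre to every point, uniformly on smaller discs (\<open>interior_bound\<close>). In several variables this
  applies to each variable separately. For derivatives in two different variables it is applied to
  difference quotients in one of them (\<open>mixed_partial_bound\<close>).
\<close>

section \<open>Wirtinger derivatives\<close>

text \<open>The numbers \<open>p\<close> and \<open>q\<close> are the Wirtinger derivatives \<open>\<partial>f/\<partial>z\<close> and \<open>\<partial>f/\<partial>z\<^sup>*\<close> of a real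
  differentiable function; all computations with the operators are done in this form.\<close>

definition wirt :: "(complex \<Rightarrow> complex) \<Rightarrow> complex \<Rightarrow> complex \<Rightarrow> complex \<Rightarrow> bool"
  where "wirt f p q z \<longleftrightarrow> (f has_derivative (\<lambda>h. p * h + q * cnj h)) (at z)"

lemma wirt_continuous: "wirt f p q z \<Longrightarrow> isCont f z"
  unfolding wirt_def by (rule has_derivative_continuous)

lemma wirt_eq_rhs: "wirt f p q z \<Longrightarrow> p = p' \<Longrightarrow> q = q' \<Longrightarrow> wirt f p' q' z"
  by simp

lemma wirt_const: "wirt (\<lambda>_. c) 0 0 z"
  by (simp add: wirt_def)

lemma wirt_add:
  assumes "wirt f p q z" "wirt g p' q' z"
  shows "wirt (\<lambda>x. f x + g x) (p + p') (q + q') z"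
  using has_derivative_add[OF assms[unfolded wirt_def]]
  by (simp add: wirt_def algebra_simps)

lemma wirt_cmult:
  assumes "wirt f p q z"
  shows "wirt (\<lambda>x. c * f x) (c * p) (c * q) z"
  using has_derivative_mult_right[OF assms[unfolded wirt_def], of c]
  by (simp add: wirt_def algebra_simps)

lemma wirt_diff:
  assumes "wirt f p q z" "wirt g p' q' z"
  shows "wirt (\<lambda>x. f x - g x) (p - p') (q - q') z"
  using has_derivative_diff[OF assms[unfolded wirt_def]]
  by (simp add: wirt_def algebra_simps)

lemma wirt_mult:
  assumes "wirt f p q z" "wirt g p' q' z"
  shows "wirt (\<lambda>x. f x * g x) (p * g z + f z * p') (q * g z + f z * q') z"
  using has_derivative_mult[OF assms[unfolded wirt_def]]
  by (simp add: wirt_def algebra_simps)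

lemma wirt_holomorphic:
  assumes "(g has_field_derivative d) (at z)"
  shows "wirt g d 0 z"
  using assms by (simp add: wirt_def has_field_derivative_def)

lemma wirt_cnj:
  assumes "wirt f p q z"
  shows "wirt (\<lambda>x. cnj (f x)) (cnj q) (cnj p) z"
  using bounded_linear.has_derivative[OF bounded_linear_cnj assms[unfolded wirt_def]]
  by (simp add: wirt_def algebra_simps)

lemma wirt_compose_holomorphic:
  assumes "wirt f p q (g z)" "(g has_field_derivative d) (at z)"
  shows "wirt (\<lambda>x. f (g x)) (p * d) (q * cnj d) z"
  using has_derivative_compose[OF assms(2)[unfolded has_field_derivative_def] assms(1)[unfolded wirt_def]]
  by (simp add: wirt_def algebra_simps)

lemma wirt_ident: "wirt (\<lambda>x. x) 1 0 z" "wirt cnj 0 1 z"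
  using bounded_linear.has_derivative[OF bounded_linear_cnj has_derivative_ident, of "at z"]
  by (auto simp add: wirt_def)

lemma wirt_curve:
  assumes "wirt f p q (g t)" "(g has_vector_derivative d) (at t within S)"
  shows "((\<lambda>x. f (g x)) has_vector_derivative (p * d + q * cnj d)) (at t within S)"
  using has_derivative_compose[OF assms(2)[unfolded has_vector_derivative_def] assms(1)[unfolded wirt_def]]
  by (simp add: has_vector_derivative_def algebra_simps scaleR_conv_of_real)

section \<open>Solutions in one variable\<close>

text \<open>The derivatives of a solution are carried along as explicit functions, because the estimates
  below compare them for different solutions and differentiate them further. One function \<open>pq\<close>
  serves for both mixed derivatives, which encodes their equality.\<close>

definition solves_L ::
    "complex \<Rightarrow> complex \<Rightarrow> (complex \<Rightarrow> complex) \<Rightarrow> (complex \<Rightarrow> complex) \<Rightarrow> (complex \<Rightarrow> complex) \<Rightarrow>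
      (complex \<Rightarrow> complex) \<Rightarrow> (complex \<Rightarrow> complex) \<Rightarrow> (complex \<Rightarrow> complex) \<Rightarrow> bool"
  where "solves_L a b f p q pp pq qq \<longleftrightarrow>
    (\<forall>z\<in>ball 0 1. wirt f (p z) (q z) z \<and> wirt p (pp z) (pq z) z \<and> wirt q (pq z) (qq z) z \<and>
       (1 - of_real ((cmod z)\<^sup>2)) * pq z + a * z * p z + b * cnj z * q z - a * b * f z = 0) \<and>
    continuous_on (ball 0 1) pp \<and> continuous_on (ball 0 1) pq \<and> continuous_on (ball 0 1) qq"

lemma solves_L_lincomb:
  assumes "solves_L a b f p q pp pq qq" "solves_L a b f' p' q' pp' pq' qq'"
  shows "solves_L a b (\<lambda>z. c * f z + d * f' z) (\<lambda>z. c * p z + d * p' z) (\<lambda>z. c * q z + d * q' z)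
     (\<lambda>z. c * pp z + d * pp' z) (\<lambda>z. c * pq z + d * pq' z) (\<lambda>z. c * qq z + d * qq' z)"
  unfolding solves_L_def
proof (intro conjI ballI)
  fix z :: complex assume z: "z \<in> ball 0 1"
  let ?L = "\<lambda>f p q pq. (1 - of_real ((cmod z)\<^sup>2)) * pq z + a * z * p z + b * cnj z * q z - a * b * f z"
  have e: "?L f p q pq = 0" "?L f' p' q' pq' = 0"
    using assms z unfolding solves_L_def by blast+
  have "(1 - of_real ((cmod z)\<^sup>2)) * (c * pq z + d * pq' z) + a * z * (c * p z + d * p' z)
      + b * cnj z * (c * q z + d * q' z) - a * b * (c * f z + d * f' z)
     = c * ?L f p q pq + d * ?L f' p' q' pq'"
    by (simp add: algebra_simps)
  then show "(1 - of_real ((cmod z)\<^sup>2)) * (c * pq z + d * pq' z) + a * z * (c * p z + d * p' z)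
      + b * cnj z * (c * q z + d * q' z) - a * b * (c * f z + d * f' z) = 0"
    unfolding e by simp
qed (use assms in \<open>auto simp: solves_L_def intro!: wirt_add wirt_cmult continuous_intros\<close>)

text \<open>Conjugation exchanges the roles of \<open>p, pp\<close> and \<open>q, qq\<close>; only the first two need to be estimated
  directly.\<close>

lemma solves_L_cnj:
  assumes "solves_L a b f p q pp pq qq"
  shows "solves_L (cnj b) (cnj a) (\<lambda>z. cnj (f z)) (\<lambda>z. cnj (q z)) (\<lambda>z. cnj (p z))
     (\<lambda>z. cnj (qq z)) (\<lambda>z. cnj (pq z)) (\<lambda>z. cnj (pp z))"
  unfolding solves_L_def
proof (intro conjI ballI)
  fix z :: complex assume z: "z \<in> ball 0 1"
  have "(1 - of_real ((cmod z)\<^sup>2)) * pq z + a * z * p z + b * cnj z * q z - a * b * f z = 0"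
    using assms z unfolding solves_L_def by blast
  then have "cnj ((1 - of_real ((cmod z)\<^sup>2)) * pq z + a * z * p z + b * cnj z * q z - a * b * f z) = 0"
    by simp
  then show "(1 - of_real ((cmod z)\<^sup>2)) * cnj (pq z) + cnj b * z * cnj (q z)
      + cnj a * cnj z * cnj (p z) - cnj b * cnj a * cnj (f z) = 0"
    by (simp add: algebra_simps)
qed (use assms in \<open>auto simp: solves_L_def intro!: wirt_cnj continuous_intros\<close>)

section \<open>Fourier modes on circles\<close>

text \<open>Up to the factor \<open>2\<pi>\<close>, the Fourier coefficient of index \<open>m\<close> of \<open>g\<close> on the circle of radius \<open>r\<close>.\<close>

definition mode :: "nat \<Rightarrow> (complex \<Rightarrow> complex) \<Rightarrow> real \<Rightarrow> complex"
  where "mode m g r = integral {0..2 * pi} (\<lambda>t. cis (- (real m * t)) * g (of_real r * cis t))"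

lemma circle_in_disc: "0 \<le> r \<Longrightarrow> r < 1 \<Longrightarrow> of_real r * cis t \<in> ball 0 1"
  by (simp add: norm_mult)

lemma mode_integrable:
  assumes "continuous_on (ball 0 1) g" "0 \<le> r" "r < 1"
  shows "(\<lambda>t. cis (- (real m * t)) * g (of_real r * cis t)) integrable_on {0..2 * pi}"
  by (intro integrable_continuous_real continuous_intros continuous_on_compose2[OF assms(1)])
     (use assms in \<open>auto simp: norm_mult intro!: continuous_intros\<close>)

lemma mode_lincomb:
  assumes "continuous_on (ball 0 1) g" "continuous_on (ball 0 1) h" "0 \<le> r" "r < 1"
  shows "mode m (\<lambda>z. c * g z + d * h z) r = c * mode m g r + d * mode m h r"
proof -
  have "mode m (\<lambda>z. c * g z + d * h z) r =
     integral {0..2 * pi} (\<lambda>t. c * (cis (- (real m * t)) * g (of_real r * cis t))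
        + d * (cis (- (real m * t)) * h (of_real r * cis t)))"
    unfolding mode_def by (simp add: algebra_simps)
  also have "\<dots> = c * mode m g r + d * mode m h r"
    using mode_integrable[OF assms(1,3,4), of m] mode_integrable[OF assms(2,3,4), of m]
    by (subst integral_add) (auto simp: mode_def intro!: integrable_on_mult_right)
  finally show ?thesis .
qed

lemma mode_norm_le:
  assumes "continuous_on (ball 0 1) g" "0 \<le> r" "r < 1" "\<And>t. norm (g (of_real r * cis t)) \<le> B"
  shows "norm (mode m g r) \<le> 2 * pi * B"
proof -
  have "norm (mode m g r) \<le> integral {0..2 * pi} (\<lambda>t. B)"
    unfolding mode_def
    by (intro integral_norm_bound_integral mode_integrable[OF assms(1-3)])
       (use assms(4) in \<open>auto simp: norm_mult\<close>)
  then show ?thesis by simp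
qed

lemma circle_derivatives:
  "((\<lambda>t. of_real r * cis t) has_vector_derivative (\<i> * (of_real r * cis t))) (at t within S)"
  "((\<lambda>r. of_real r * cis t) has_vector_derivative cis t) (at r within S')"
  unfolding has_vector_derivative_complex_iff
  by (auto intro!: derivative_eq_intros simp: has_real_derivative_iff_has_vector_derivative[symmetric])

lemma cis_derivative:
  "((\<lambda>t. cis (c * t)) has_vector_derivative (\<i> * of_real c * cis (c * t))) (at t within S)"
  unfolding has_vector_derivative_complex_iff
  by (auto intro!: derivative_eq_intros simp: has_real_derivative_iff_has_vector_derivative[symmetric])

text \<open>Integration by parts along the circle: the angular derivative of \<open>g\<close> is
  \<open>\<i> (z g\<^sub>z - z\<^sup>* g\<^sub>w)\<close>, and the boundary terms cancel by periodicity.\<close>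

lemma mode_angular:
  assumes g: "\<And>z. z \<in> ball 0 1 \<Longrightarrow> wirt g (gz z) (gw z) z"
    and gz: "continuous_on (ball 0 1) gz" and gw: "continuous_on (ball 0 1) gw"
    and r: "0 \<le> r" "r < 1"
  shows "mode m (\<lambda>z. z * gz z) r - mode m (\<lambda>z. cnj z * gw z) r = of_nat m * mode m g r"
proof -
  let ?z = "\<lambda>t. of_real r * cis t"
  have g_cont: "continuous_on (ball 0 1) g"
    by (intro continuous_at_imp_continuous_on ballI wirt_continuous[OF g])
  have "((\<lambda>t. cis (- real m * t) * (?z t * gz (?z t)) - cis (- real m * t) * (cnj (?z t) * gw (?z t))
          - of_nat m * (cis (- real m * t) * g (?z t)))
      has_integral (- \<i> * (cis (- real m * (2*pi)) * g (?z (2*pi))) - (- \<i>) * (cis (- real m * 0) * g (?z 0))))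
      {0..2*pi}"
  proof (rule fundamental_theorem_of_calculus, simp)
    fix t :: real
    show "((\<lambda>t. - \<i> * (cis (- real m * t) * g (?z t))) has_vector_derivative
       (cis (- real m * t) * (?z t * gz (?z t)) - cis (- real m * t) * (cnj (?z t) * gw (?z t))
          - of_nat m * (cis (- real m * t) * g (?z t)))) (at t within {0..2*pi})"
      by (rule derivative_eq_intros cis_derivative
           wirt_curve[OF g[OF circle_in_disc[OF r]] circle_derivatives(1)] refl)+
         (simp add: algebra_simps)
  qed
  moreover have "cis (- real m * (2*pi)) = 1"
    using cis_multiple_2pi[of "- real m"] by (simp add: mult.commute)
  ultimately have "((\<lambda>t. cis (- real m * t) * (?z t * gz (?z t)) - cis (- real m * t) * (cnj (?z t) * gw (?z t))
          - of_nat m * (cis (- real m * t) * g (?z t))) has_integral 0) {0..2*pi}"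
    by simp
  then have "integral {0..2*pi} (\<lambda>t. cis (- real m * t) * (?z t * gz (?z t)) - cis (- real m * t) * (cnj (?z t) * gw (?z t))
          - of_nat m * (cis (- real m * t) * g (?z t))) = 0"
    by (rule integral_unique)
  moreover have "continuous_on (ball 0 1) (\<lambda>z. z * gz z)" "continuous_on (ball 0 1) (\<lambda>z. cnj z * gw z)"
    by (intro continuous_intros gz gw)+
  ultimately show ?thesis
    unfolding mode_def
    using mode_integrable[OF _ r, of "\<lambda>z. z * gz z" m] mode_integrable[OF _ r, of "\<lambda>z. cnj z * gw z" m]
       mode_integrable[OF g_cont r, of m]
    by (simp add: integral_diff integrable_diff integrable_on_mult_right)
qed

text \<open>Differentiation under the integral sign, where \<open>r \<partial>/\<partial>r = z \<partial>/\<partial>z + z\<^sup>* \<partial>/\<partial>z\<^sup>*\<close>.\<close>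

lemma mode_radial:
  assumes g: "\<And>z. z \<in> ball 0 1 \<Longrightarrow> wirt g (gz z) (gw z) z"
    and gz: "continuous_on (ball 0 1) gz" and gw: "continuous_on (ball 0 1) gw"
    and r: "0 < r" "r < 1"
  shows "(mode m g has_vector_derivative
      ((mode m (\<lambda>z. z * gz z) r + mode m (\<lambda>z. cnj z * gw z) r) / of_real r)) (at r)"
proof -
  let ?z = "\<lambda>r t. of_real r * cis t"
  have g_cont: "continuous_on (ball 0 1) g"
    by (intro continuous_at_imp_continuous_on ballI wirt_continuous[OF g])
  let ?d = "\<lambda>r t. cis (- (real m * t)) * (gz (?z r t) * cis t + gw (?z r t) * cnj (cis t))"
  have "(mode m g has_vector_derivative integral (cbox 0 (2*pi)) (?d r)) (at r within {0<..<1})"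
    unfolding mode_def [abs_def] cbox_interval[symmetric]
  proof (rule leibniz_rule_vector_derivative)
    fix x t :: real assume x: "x \<in> {0<..<1}" and t: "t \<in> cbox 0 (2*pi)"
    show "((\<lambda>x. cis (- (real m * t)) * g (?z x t)) has_vector_derivative ?d x t) (at x within {0<..<1})"
      by (intro has_vector_derivative_mult_right wirt_curve[OF g circle_derivatives(2)] circle_in_disc)
         (use x in auto)
  next
    fix x :: real assume "x \<in> {0<..<1}"
    then show "(\<lambda>t. cis (- (real m * t)) * g (?z x t)) integrable_on cbox 0 (2*pi)"
      using mode_integrable[OF g_cont, of x m] by simp
  next
    show "continuous_on ({0<..<1} \<times> cbox 0 (2 * pi)) (\<lambda>(x, t). ?d x t)"
      unfolding case_prod_beta
      by (intro continuous_intros continuous_on_compose2[OF gz] continuous_on_compose2[OF gw])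
         (auto simp: norm_mult)
  qed (use r in auto)
  then have "(mode m g has_vector_derivative integral {0..2*pi} (?d r)) (at r)"
    using r by (simp add: at_within_open[of r "{0<..<1}"])
  moreover have "integral {0..2*pi} (?d r) =
      (mode m (\<lambda>z. z * gz z) r + mode m (\<lambda>z. cnj z * gw z) r) / of_real r"
  proof -
    have c: "continuous_on (ball 0 1) (\<lambda>z. z * gz z)" "continuous_on (ball 0 1) (\<lambda>z. cnj z * gw z)"
      by (intro continuous_intros gz gw)+
    have "?d r = (\<lambda>t. (cis (- (real m * t)) * (?z r t * gz (?z r t))
         + cis (- (real m * t)) * (cnj (?z r t) * gw (?z r t))) / of_real r)"
      using r by (auto simp: field_simps)
    then have "integral {0..2*pi} (?d r) = integral {0..2*pi} (\<lambda>t. cis (- (real m * t)) * (?z r t * gz (?z r t))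
         + cis (- (real m * t)) * (cnj (?z r t) * gw (?z r t))) / of_real r"
      by simp
    then show ?thesis
      unfolding mode_def using mode_integrable[OF c(1), of r m] mode_integrable[OF c(2), of r m] r
      by (simp add: integral_add)
  qed
  ultimately show ?thesis by simp
qed

section \<open>Uniqueness for a singular system of ordinary differential equations\<close>

lemma continuous_extension_by_zero:
  fixes f :: "real \<Rightarrow> 'a::real_normed_vector"
  assumes "(f \<longlongrightarrow> 0) (at_right 0)" and "continuous_on {0<..r} f"
  shows "continuous_on {0..r} (\<lambda>t. if t \<le> 0 then 0 else f t)"
proof (cases "0 < r")
  case True
  let ?g = "\<lambda>t. if t \<le> 0 then 0 else f t"
  have "(?g \<longlongrightarrow> ?g 0) (at_right 0)"
    using assms(1) Lim_transform_eventually[of f 0 "at_right 0" ?g]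
    using gt_ex[of "0::real"] by (auto simp: eventually_at_right_field)
  then have "continuous (at 0 within {0..r}) ?g"
    using True by (simp add: continuous_within at_within_Icc_at_right)
  moreover have "continuous (at t within {0..r}) ?g" if t: "t \<in> {0<..r}" for t
  proof -
    have "continuous_on {0<..r} ?g"
      using assms(2) by (rule continuous_on_eq) auto
    then have "continuous (at t within {0<..r}) ?g"
      using t by (simp add: continuous_on_eq_continuous_within)
    moreover have "at t within {0..r} = at t within {0<..r}"
      by (rule at_within_nhd[of t "{0<..}"]) (use t in auto)
    ultimately show ?thesis by simp
  qed
  ultimately show ?thesis
    unfolding continuous_on_eq_continuous_within
    by (metis atLeastAtMost_iff greaterThanAtMost_iff order_less_le)
next
  case False
  then have "{0..r} \<subseteq> {0}" by auto
  then show ?thesis by (meson continuous_on_sing continuous_on_subset)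
qed

text \<open>The mean value inequality on \<open>(0, r]\<close>, for a function that is known only through its limit at \<open>0\<close>.\<close>

lemma norm_le_of_derivative_bound:
  fixes f :: "real \<Rightarrow> complex"
  assumes "(f \<longlongrightarrow> 0) (at_right 0)" "0 < r"
    and d: "\<And>t. 0 < t \<Longrightarrow> t \<le> r \<Longrightarrow> (f has_vector_derivative f' t) (at t)"
    and b: "\<And>t. 0 < t \<Longrightarrow> t \<le> r \<Longrightarrow> norm (f' t) \<le> B"
  shows "norm (f r) \<le> B * r"
proof -
  let ?g = "\<lambda>t. if t \<le> 0 then 0 else f t"
  have "continuous_on {0<..r} f"
    by (intro continuous_at_imp_continuous_on ballI has_vector_derivative_continuous[OF d]) auto
  then have "continuous_on {0..r} ?g"
    by (rule continuous_extension_by_zero[OF assms(1)])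
  moreover have "(?g has_derivative (\<lambda>h. h *\<^sub>R f' t)) (at t)" if "0 < t" "t < r" for t
    using d[of t] that unfolding has_vector_derivative_def
    by (auto intro: has_derivative_transform_within_open[OF _ open_greaterThan[of 0]])
  ultimately obtain x where x: "x \<in> {0<..<r}" "norm (?g r - ?g 0) \<le> norm ((r - 0) *\<^sub>R f' x)"
    using mvt_general[OF \<open>0 < r\<close>, of ?g "\<lambda>t h. h *\<^sub>R f' t"] by auto
  have "norm (f r) \<le> r * norm (f' x)"
    using x \<open>0 < r\<close> by simp
  also have "\<dots> \<le> r * B"
    using b[of x] x \<open>0 < r\<close> by (intro mult_left_mono) auto
  finally show ?thesis by (simp add: mult.commute)
qed

text \<open>The system is singular at the origin with indices \<open>m\<close> and \<open>-m\<close>, so the decay \<open>o(r\<^sup>m)\<close> of both unknowns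
  excludes every nonzero solution. The integrating factors \<open>r\<^sup>-\<^sup>m\<close> and \<open>r\<^sup>m\<close> turn the equations into
  integrable ones, and the resulting integral inequalities show that the weighted maximum of
  \<open>X\<close> and \<open>Y\<close> is at most half of itself on \<open>(0, \<rho>]\<close>. The length \<open>\<rho>\<close> depends only on \<open>K\<close>, not on
  the solution.\<close>

lemma singular_system_unique:
  fixes X Y H :: "real \<Rightarrow> complex"
  assumes X: "\<And>r. 0 < r \<Longrightarrow> r \<le> \<rho> \<Longrightarrow>
      (X has_vector_derivative ((of_nat m * X r + of_real (r\<^sup>2) * H r) / of_real r)) (at r)"
    and Y: "\<And>r. 0 < r \<Longrightarrow> r \<le> \<rho> \<Longrightarrow>
      (Y has_vector_derivative ((- of_nat m * Y r + of_real (r\<^sup>2) * H r) / of_real r)) (at r)"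
    and H: "\<And>r. 0 < r \<Longrightarrow> r \<le> \<rho> \<Longrightarrow> norm (H r) \<le> K * (norm (X r) + norm (Y r))"
    and X0: "((\<lambda>r. X r / of_real (r ^ m)) \<longlongrightarrow> 0) (at_right 0)"
    and Y0: "((\<lambda>r. Y r / of_real (r ^ m)) \<longlongrightarrow> 0) (at_right 0)"
    and \<rho>: "0 < \<rho>" "\<rho> \<le> 1" "4 * K * \<rho> \<le> 1" and K: "0 \<le> K"
    and r: "0 < r" "r \<le> \<rho>"
  shows "X r = 0 \<and> Y r = 0"
proof -
  define G where "G = (\<lambda>t. norm (X t / of_real (t ^ m)) + norm (Y t / of_real (t ^ m)))"
  have Xc: "continuous_on {0<..\<rho>} X"
    by (intro continuous_at_imp_continuous_on ballI has_vector_derivative_continuous[OF X]) auto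
  have Yc: "continuous_on {0<..\<rho>} Y"
    by (intro continuous_at_imp_continuous_on ballI has_vector_derivative_continuous[OF Y]) auto
  have "(G \<longlongrightarrow> norm (0::complex) + norm (0::complex)) (at_right 0)"
    unfolding G_def by (intro tendsto_intros X0 Y0)
  then have G0: "(G \<longlongrightarrow> 0) (at_right 0)" by simp
  have "continuous_on {0<..\<rho>} G"
    unfolding G_def by (intro continuous_intros Xc Yc) auto
  then have "continuous_on {0..\<rho>} (\<lambda>t. if t \<le> 0 then 0 else G t)"
    by (rule continuous_extension_by_zero[OF G0])
  then obtain s where s: "s \<in> {0..\<rho>}"
    and smax: "\<And>t. t \<in> {0..\<rho>} \<Longrightarrow> (if t \<le> 0 then 0 else G t) \<le> (if s \<le> 0 then 0 else G s)"
    using continuous_attains_sup[of "{0..\<rho>}" "\<lambda>t. if t \<le> 0 then 0 else G t"] \<rho> by auto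
  \<comment> \<open>maximum of the weighted size; the claim is that it vanishes\<close>
  define S where "S = (if s \<le> 0 then 0 else G s)"
  have S0: "0 \<le> S" unfolding S_def G_def by auto
  have XY_le: "norm (X t) + norm (Y t) \<le> S * t ^ m" if "0 < t" "t \<le> \<rho>" for t
  proof -
    have "G t \<le> S" using smax[of t] that unfolding S_def by auto
    then show ?thesis
      using that unfolding G_def by (simp add: norm_divide norm_power field_simps)
  qed
  have H_le: "norm (H t) \<le> K * (S * t ^ m)" if "0 < t" "t \<le> \<rho>" for t
    using H[OF that] XY_le[OF that] K by (meson mult_left_mono order_trans)
  have "G t \<le> 2 * K * S * t" if t: "0 < t" "t \<le> \<rho>" for t
  proof -
    have "norm (X t / of_real (t ^ m)) \<le> (K * S * t) * t"
    proof (rule norm_le_of_derivative_bound[OF X0 t(1)])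
      fix x :: real assume x: "0 < x" "x \<le> t"
      have x\<rho>: "x \<le> \<rho>" using x t by simp
      show "((\<lambda>r. X r / of_real (r ^ m)) has_vector_derivative (of_real x * H x / of_real (x ^ m))) (at x)"
      proof (cases m)
        case 0
        show ?thesis using X[OF x(1) x\<rho>] x 0 by (simp add: power2_eq_square)
      next
        case (Suc k)
        have "((\<lambda>r. of_real (r powi - int m) * X r) has_vector_derivative
            (of_real (x powi - int m) * ((of_nat m * X x + of_real (x\<^sup>2) * H x) / of_real x)
             + of_real (- of_int (int m) * x powi (- int m - 1)) * X x)) (at x)"
          by (intro has_vector_derivative_mult X[OF x(1) x\<rho>] has_vector_derivative_of_real)
             (use x in \<open>auto intro!: derivative_eq_intros simp: has_real_derivative_iff_has_vector_derivative[symmetric]\<close>)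
        moreover have "(of_real (x powi - int m) * ((of_nat m * X x + of_real (x\<^sup>2) * H x) / of_real x)
             + of_real (- of_int (int m) * x powi (- int m - 1)) * X x) = of_real x * H x / of_real (x ^ m)"
          using x by (simp add: power_int_minus power_int_diff field_simps power2_eq_square)
        moreover have "(\<lambda>r. of_real (r powi - int m) * X r) = (\<lambda>r. X r / of_real (r ^ m))"
          by (auto simp: power_int_minus field_simps)
        ultimately show ?thesis by simp
      qed
      have "norm (of_real x * H x / of_real (x ^ m)) = x * norm (H x) / x ^ m"
        using x by (simp add: norm_mult norm_divide norm_power)
      also have "\<dots> \<le> x * (K * (S * x ^ m)) / x ^ m"
        by (intro divide_right_mono mult_left_mono H_le[OF x(1) x\<rho>]) (use x in auto)
      also have "\<dots> = K * S * x" using x by simp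
      also have "\<dots> \<le> K * S * t" using x K S0 by (intro mult_left_mono) auto
      finally show "norm (of_real x * H x / of_real (x ^ m)) \<le> K * S * t" .
    qed
    also have "\<dots> \<le> K * S * t"
      using t \<rho> K S0 by (intro mult_left_le) auto
    finally have 1: "norm (X t / of_real (t ^ m)) \<le> K * S * t" .
    have Y1: "((\<lambda>r. of_real (r ^ m) * Y r) \<longlongrightarrow> 0) (at_right 0)"
    proof -
      have "((\<lambda>r. of_real (r ^ m * r ^ m) * (Y r / of_real (r ^ m))) \<longlongrightarrow> of_real (0 ^ m * 0 ^ m) * 0) (at_right 0)"
        by (intro tendsto_intros Y0)
      then have "((\<lambda>r. of_real (r ^ m * r ^ m) * (Y r / of_real (r ^ m))) \<longlongrightarrow> 0) (at_right 0)"
        by simp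
      then show ?thesis
        by (rule Lim_transform_eventually)
           (auto simp: eventually_at_right_field intro!: exI[of _ 1])
    qed
    have "norm (of_real (t ^ m) * Y t) \<le> (K * S * t ^ (2 * m + 1)) * t"
    proof (rule norm_le_of_derivative_bound[OF Y1 t(1)])
      fix x :: real assume x: "0 < x" "x \<le> t"
      have x\<rho>: "x \<le> \<rho>" using x t by simp
      have "((\<lambda>r. of_real (r ^ m) * Y r) has_vector_derivative
            (of_real (x ^ m) * ((- of_nat m * Y x + of_real (x\<^sup>2) * H x) / of_real x)
             + of_real (real m * x ^ (m - 1)) * Y x)) (at x)"
        by (intro has_vector_derivative_mult Y[OF x(1) x\<rho>] has_vector_derivative_of_real)
           (auto intro!: derivative_eq_intros simp: has_real_derivative_iff_has_vector_derivative[symmetric])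
      moreover have "(of_real (x ^ m) * ((- of_nat m * Y x + of_real (x\<^sup>2) * H x) / of_real x)
             + of_real (real m * x ^ (m - 1)) * Y x) = of_real (x ^ (m + 1)) * H x"
        using x by (cases m) (simp_all add: field_simps power2_eq_square)
      ultimately show "((\<lambda>r. of_real (r ^ m) * Y r) has_vector_derivative (of_real (x ^ (m + 1)) * H x)) (at x)"
        by simp
      have "norm (of_real (x ^ (m + 1)) * H x) \<le> x ^ (m + 1) * (K * (S * x ^ m))"
        using x H_le[OF x(1) x\<rho>] by (simp add: norm_mult norm_power mult_left_mono)
      also have "\<dots> = K * S * x ^ (2 * m + 1)"
        by (simp add: mult_2 power_add)
      also have "\<dots> \<le> K * S * t ^ (2 * m + 1)"
        using x K S0 by (intro mult_left_mono power_mono) auto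
      finally show "norm (of_real (x ^ (m + 1)) * H x) \<le> K * S * t ^ (2 * m + 1)" .
    qed
    moreover have "norm (of_real (t ^ m) * Y t) = t ^ m * norm (Y t)"
      using t by (simp add: norm_mult norm_power)
    moreover have "(K * S * t ^ (2 * m + 1)) * t = t ^ m * (t ^ m * (K * S * t * t))"
      by (simp add: mult_2 power_add)
    ultimately have "norm (Y t) \<le> t ^ m * (K * S * t * t)"
      using t by (simp only: mult_le_cancel_left_pos zero_less_power)
    then have "norm (Y t / of_real (t ^ m)) \<le> K * S * t * t"
      using t by (simp add: norm_divide norm_power field_simps)
    also have "\<dots> \<le> K * S * t"
      using t \<rho> K S0 by (intro mult_left_le) auto
    finally show ?thesis using 1 unfolding G_def by simp
  qed
  then have "S \<le> 2 * K * S * \<rho>" if "0 < s"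
  proof -
    have "S \<le> 2 * K * S * s" using that s \<open>\<And>t. 0 < t \<Longrightarrow> t \<le> \<rho> \<Longrightarrow> G t \<le> 2 * K * S * t\<close>[of s]
      unfolding S_def by auto
    also have "\<dots> \<le> 2 * K * S * \<rho>" using s K S0 by (intro mult_left_mono) auto
    finally show ?thesis .
  qed
  moreover have "2 * K * S * \<rho> \<le> S / 2"
    using mult_right_mono[OF \<rho>(3) S0] by (simp add: algebra_simps)
  ultimately have "S \<le> 0" using S_def by (cases "0 < s") auto
  then have "norm (X r) + norm (Y r) \<le> 0"
    using XY_le[OF r] S0 by (metis order_antisym mult_zero_left)
  then show ?thesis
    using add_nonneg_eq_0_iff[of "norm (X r)" "norm (Y r)"] by (simp add: order_antisym)
qed

lemma solves_L_continuous:
  assumes "solves_L a b f p q pp pq qq"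
  shows "continuous_on (ball 0 1) f" "continuous_on (ball 0 1) p" "continuous_on (ball 0 1) q"
  using assms unfolding solves_L_def
  by (blast intro: continuous_at_imp_continuous_on wirt_continuous)+

text \<open>With \<open>X\<close> and \<open>Y\<close> the modes of \<open>z f\<^sub>z\<close> and \<open>z\<^sup>* f\<^sub>w\<close>, the second order ordinary differential equation
  satisfied by the mode of a solution becomes a first order system, closed by the last two
  identities. It involves only the mixed second derivative of \<open>f\<close>.\<close>

lemma mode_system:
  fixes m :: nat
  assumes s: "solves_L a b f p q pp pq qq" and r: "0 < r" "r < 1"
  defines "X \<equiv> mode m (\<lambda>z. z * p z)" and "Y \<equiv> mode m (\<lambda>z. cnj z * q z)"
    and "H \<equiv> (\<lambda>r. 2 * mode m pq r)"
  shows "(X has_vector_derivative ((of_nat m * X r + of_real (r\<^sup>2) * H r) / of_real r)) (at r)"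
    and "(Y has_vector_derivative ((- of_nat m * Y r + of_real (r\<^sup>2) * H r) / of_real r)) (at r)"
    and "of_nat m * mode m f r = X r - Y r"
    and "(1 - of_real (r\<^sup>2)) * mode m pq r = - a * X r - b * Y r + a * b * mode m f r"
proof -
  note c = solves_L_continuous[OF s]
  have c2: "continuous_on (ball 0 1) pp" "continuous_on (ball 0 1) pq" "continuous_on (ball 0 1) qq"
    and w: "\<And>z. z \<in> ball 0 1 \<Longrightarrow> wirt f (p z) (q z) z"
       "\<And>z. z \<in> ball 0 1 \<Longrightarrow> wirt p (pp z) (pq z) z"
       "\<And>z. z \<in> ball 0 1 \<Longrightarrow> wirt q (pq z) (qq z) z"
    and L: "\<And>z. z \<in> ball 0 1 \<Longrightarrow>
      (1 - of_real ((cmod z)\<^sup>2)) * pq z + a * z * p z + b * cnj z * q z - a * b * f z = 0"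
    using s unfolding solves_L_def by auto
  have r': "0 \<le> r" using r by simp
  show "of_nat m * mode m f r = X r - Y r"
    unfolding X_def Y_def using mode_angular[OF w(1) c(2,3) r' r(2), of m] by simp
  have sq: "mode m (\<lambda>z. z * (cnj z * g z)) r = of_real (r\<^sup>2) * mode m g r"
      "mode m (\<lambda>z. cnj z * (z * g z)) r = of_real (r\<^sup>2) * mode m g r" for g
  proof -
    have *: "of_real r * cis t * (cnj (of_real r * cis t) * y) = of_real (r\<^sup>2) * y"
       "cnj (of_real r * cis t) * (of_real r * cis t * y) = of_real (r\<^sup>2) * y" for y t
    proof -
      have "of_real r * cis t * cnj (of_real r * cis t) = of_real (r\<^sup>2)"
        using complex_norm_square[of "of_real r * cis t"] r by (simp add: norm_mult)
      then show "of_real r * cis t * (cnj (of_real r * cis t) * y) = of_real (r\<^sup>2) * y"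
       "cnj (of_real r * cis t) * (of_real r * cis t * y) = of_real (r\<^sup>2) * y"
        by (metis mult.assoc, metis mult.assoc mult.commute)
    qed
    have "(\<lambda>t. cis (- (real m * t)) * (of_real r * cis t * (cnj (of_real r * cis t) * g (of_real r * cis t))))
       = (\<lambda>t. of_real (r\<^sup>2) * (cis (- (real m * t)) * g (of_real r * cis t)))"
      "(\<lambda>t. cis (- (real m * t)) * (cnj (of_real r * cis t) * (of_real r * cis t * g (of_real r * cis t))))
       = (\<lambda>t. of_real (r\<^sup>2) * (cis (- (real m * t)) * g (of_real r * cis t)))"
      unfolding * by (simp_all add: mult_ac)
    then show "mode m (\<lambda>z. z * (cnj z * g z)) r = of_real (r\<^sup>2) * mode m g r"
      "mode m (\<lambda>z. cnj z * (z * g z)) r = of_real (r\<^sup>2) * mode m g r"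
      unfolding mode_def by simp_all
  qed
  have wX: "wirt (\<lambda>z. z * p z) (p z + z * pp z) (z * pq z) z" if "z \<in> ball 0 1" for z
    by (rule wirt_eq_rhs[OF wirt_mult[OF wirt_ident(1) w(2)[OF that]]]) auto
  have wY: "wirt (\<lambda>z. cnj z * q z) (cnj z * pq z) (q z + cnj z * qq z) z" if "z \<in> ball 0 1" for z
    by (rule wirt_eq_rhs[OF wirt_mult[OF wirt_ident(2) w(3)[OF that]]]) auto
  have cX: "continuous_on (ball 0 1) (\<lambda>z. p z + z * pp z)" "continuous_on (ball 0 1) (\<lambda>z. z * pq z)"
    and cY: "continuous_on (ball 0 1) (\<lambda>z. cnj z * pq z)" "continuous_on (ball 0 1) (\<lambda>z. q z + cnj z * qq z)"
    by (intro continuous_intros c c2)+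
  have "mode m (\<lambda>z. z * (p z + z * pp z)) r - of_real (r\<^sup>2) * mode m pq r = of_nat m * X r"
    using mode_angular[OF wX cX r' r(2), of m] unfolding sq X_def .
  then show "(X has_vector_derivative ((of_nat m * X r + of_real (r\<^sup>2) * H r) / of_real r)) (at r)"
    using mode_radial[OF wX cX r, of m] unfolding X_def[symmetric] sq H_def
    by (simp add: algebra_simps)
  have "of_real (r\<^sup>2) * mode m pq r - mode m (\<lambda>z. cnj z * (q z + cnj z * qq z)) r = of_nat m * Y r"
    using mode_angular[OF wY cY r' r(2), of m] unfolding sq Y_def .
  then show "(Y has_vector_derivative ((- of_nat m * Y r + of_real (r\<^sup>2) * H r) / of_real r)) (at r)"
    using mode_radial[OF wY cY r, of m] unfolding Y_def[symmetric] sq H_def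
    by (simp add: algebra_simps)
  have "(\<lambda>t. cis (- (real m * t)) * ((1 - of_real (r\<^sup>2)) * pq (of_real r * cis t)))
     = (\<lambda>t. cis (- (real m * t)) * (1 * ((- a) * (of_real r * cis t * p (of_real r * cis t))
          + (- b) * (cnj (of_real r * cis t) * q (of_real r * cis t)))
          + (a * b) * f (of_real r * cis t)))"
  proof
    fix t
    have "(1 - of_real (r\<^sup>2)) * pq (of_real r * cis t)
        + a * (of_real r * cis t) * p (of_real r * cis t)
        + b * cnj (of_real r * cis t) * q (of_real r * cis t) - a * b * f (of_real r * cis t) = 0"
      using L[OF circle_in_disc[OF r' r(2), of t]] r by (simp add: norm_mult)
    then have "(1 - of_real (r\<^sup>2)) * pq (of_real r * cis t) =
       1 * ((- a) * (of_real r * cis t * p (of_real r * cis t))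
          + (- b) * (cnj (of_real r * cis t) * q (of_real r * cis t)))
          + (a * b) * f (of_real r * cis t)"
      by (simp only: mult_minus_left mult_1_left) (simp add: algebra_simps add_eq_0_iff)
    then show "cis (- (real m * t)) * ((1 - of_real (r\<^sup>2)) * pq (of_real r * cis t))
     = cis (- (real m * t)) * (1 * ((- a) * (of_real r * cis t * p (of_real r * cis t))
          + (- b) * (cnj (of_real r * cis t) * q (of_real r * cis t)))
          + (a * b) * f (of_real r * cis t))"
      by simp
  qed
  then have "mode m (\<lambda>z. (1 - of_real (r\<^sup>2)) * pq z) r =
     mode m (\<lambda>z. 1 * ((- a) * (z * p z) + (- b) * (cnj z * q z)) + (a * b) * f z) r"
    unfolding mode_def by simp
  moreover have "mode m (\<lambda>z. (1 - of_real (r\<^sup>2)) * pq z) r = (1 - of_real (r\<^sup>2)) * mode m pq r"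
    using mode_lincomb[OF c2(2) c2(2) r' r(2), of m "1 - of_real (r\<^sup>2)" 0] by simp
  moreover have "mode m (\<lambda>z. 1 * ((- a) * (z * p z) + (- b) * (cnj z * q z)) + (a * b) * f z) r
     = 1 * ((- a) * X r + (- b) * Y r) + a * b * mode m f r"
    unfolding X_def Y_def
    by (subst mode_lincomb, (intro continuous_intros c r r')+, subst mode_lincomb)
       (intro continuous_intros c r r' refl)+
  ultimately show "(1 - of_real (r\<^sup>2)) * mode m pq r = - a * X r - b * Y r + a * b * mode m f r"
    by simp
qed

section \<open>Estimates at the centre of the disc\<close>

lemma mode_monomials:
  assumes "0 \<le> r" "r < 1"
  shows "mode j (\<lambda>_. c) r = (if j = 0 then 2 * of_real pi * c else 0)"
    and "1 \<le> j \<Longrightarrow> mode j (\<lambda>z. z) r = (if j = 1 then 2 * of_real pi * of_real r else 0)"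
    and "1 \<le> j \<Longrightarrow> mode j cnj r = 0"
proof -
  have zero: "mode j (\<lambda>_. 0) r = 0" for j
    by (simp add: mode_def)
  show "mode j (\<lambda>_. c) r = (if j = 0 then 2 * of_real pi * c else 0)"
    using mode_angular[where g="\<lambda>_. c" and gz="\<lambda>_. 0" and gw="\<lambda>_. 0" and r=r and m=j, OF wirt_const] assms
    by (cases "j = 0") (auto simp: zero mode_def scaleR_conv_of_real)
  show "mode j (\<lambda>z. z) r = (if j = 1 then 2 * of_real pi * of_real r else 0)" if "1 \<le> j"
  proof (cases "j = 1")
    case True
    have "cis (- t) * cis t = 1" for t by (simp add: cis_mult)
    then have *: "(\<lambda>t. cis (- t) * (of_real r * cis t)) = (\<lambda>t. of_real r)"
      by (metis mult.left_commute mult.right_neutral)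
    show ?thesis unfolding True by (simp add: mode_def * scaleR_conv_of_real)
  next
    case False
    have "mode j (\<lambda>z. z) r = of_nat j * mode j (\<lambda>z. z) r"
      using mode_angular[where g="\<lambda>z. z" and gz="\<lambda>_. 1" and gw="\<lambda>_. 0" and r=r and m=j, OF wirt_ident(1)] assms by (simp add: zero)
    then show ?thesis using False by simp
  qed
  show "mode j cnj r = 0" if "1 \<le> j"
  proof -
    have "- mode j cnj r = of_nat j * mode j cnj r"
      using mode_angular[where g=cnj and gz="\<lambda>_. 0" and gw="\<lambda>_. 1" and r=r and m=j, OF wirt_ident(2)] assms by (simp add: zero)
    then have "of_nat (j + 1) * mode j cnj r = 0"
      by (simp add: algebra_simps eq_neg_iff_add_eq_0 neg_eq_iff_add_eq_0)
    then show ?thesis by (metis Suc_eq_plus1 mult_eq_0_iff of_nat_eq_0_iff nat.distinct(2))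
  qed
qed

text \<open>Multiplication by \<open>z\<close> or \<open>z\<^sup>*\<close> on a circle shifts the Fourier index.\<close>

lemma mode_shift:
  "mode (Suc j) (\<lambda>z. z * g z) r = of_real r * mode j g r"
  "mode j (\<lambda>z. cnj z * g z) r = of_real r * mode (Suc j) g r"
proof -
  have 1: "cis (- (real (Suc j) * t)) * cis t = cis (- (real j * t))" for t
    by (simp add: cis_mult algebra_simps)
  have 2: "cis (- (real j * t)) * cnj (cis t) = cis (- (real (Suc j) * t))" for t
    by (simp add: cis_cnj cis_mult algebra_simps)
  have "(\<lambda>t. cis (- (real (Suc j) * t)) * (of_real r * cis t * g (of_real r * cis t)))
     = (\<lambda>t. of_real r * (cis (- (real j * t)) * g (of_real r * cis t)))"
    unfolding 1[symmetric] by (simp add: mult_ac)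
  then show "mode (Suc j) (\<lambda>z. z * g z) r = of_real r * mode j g r"
    unfolding mode_def by simp
  have "(\<lambda>t. cis (- (real j * t)) * (cnj (of_real r * cis t) * g (of_real r * cis t)))
     = (\<lambda>t. of_real r * (cis (- (real (Suc j) * t)) * g (of_real r * cis t)))"
    unfolding 2[symmetric] by (simp add: mult_ac)
  then show "mode j (\<lambda>z. cnj z * g z) r = of_real r * mode (Suc j) g r"
    unfolding mode_def by simp
qed

lemma mode_tendsto_0:
  assumes g: "continuous_on (ball 0 1) g"
  shows "(mode j g \<longlongrightarrow> (if j = 0 then 2 * of_real pi * g 0 else 0)) (at_right 0)"
proof (rule tendstoI)
  let ?l = "if j = 0 then 2 * of_real pi * g 0 else 0"
  fix e :: real assume e: "e > 0"
  have "isCont g 0" using g by (simp add: continuous_on_eq_continuous_at)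
  then obtain d where d: "d > 0" "\<And>z. dist z 0 < d \<Longrightarrow> dist (g z) (g 0) < e / 8"
    using e unfolding continuous_at_eps_delta by (metis divide_pos_pos zero_less_numeral)
  have "dist (mode j g r) ?l < e" if r: "0 < r" "r < min d 1" for r
  proof -
    have "mode j g r - ?l = mode j (\<lambda>z. 1 * g z + (-1) * g 0) r"
      using r by (subst mode_lincomb[OF g continuous_on_const]) (auto simp: mode_monomials)
    also have "norm \<dots> \<le> 2 * pi * (e / 8)"
    proof (rule mode_norm_le)
      fix t
      show "norm (1 * g (of_real r * cis t) + (-1) * g 0) \<le> e / 8"
        using d(2)[of "of_real r * cis t"] r by (simp add: norm_mult dist_norm)
    qed (use r in \<open>auto intro!: continuous_intros g\<close>)
    also have "\<dots> < e" using pi_less_4 e by simp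
    finally show ?thesis by (simp add: dist_norm)
  qed
  then show "\<forall>\<^sub>F r in at_right 0. dist (mode j g r) ?l < e"
    unfolding eventually_at_right_field using d(1) by (intro exI[of _ "min d 1"]) auto
qed

text \<open>Only the term \<open>A z\<close> of the first order expansion of \<open>g\<close> at \<open>0\<close> has a nonzero mode of positive index.\<close>

lemma mode_divide_tendsto:
  assumes g: "continuous_on (ball 0 1) g" and w: "wirt g A B 0" and j: "1 \<le> j"
  shows "((\<lambda>r. mode j g r / of_real r) \<longlongrightarrow> (if j = 1 then 2 * of_real pi * A else 0)) (at_right 0)"
proof (rule tendstoI)
  let ?l = "if j = 1 then 2 * of_real pi * A else 0"
  fix e :: real assume e: "e > 0"
  obtain d where d: "d > 0" "\<And>z. norm z < d \<Longrightarrow> norm (g z - g 0 - (A * z + B * cnj z)) \<le> e / 8 * norm z"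
    using w[unfolded wirt_def has_derivative_at_alt, THEN conjunct2, rule_format, of "e / 8"] e
    by auto
  have "dist (mode j g r / of_real r) ?l < e" if r: "0 < r" "r < min d 1" for r
  proof -
    have "mode j g r - of_real r * ?l = mode j (\<lambda>z. 1 * g z + (-1) * (1 * g 0 + 1 * (A * z + B * cnj z))) r"
      using r j by (subst mode_lincomb, (auto intro!: continuous_intros g)[4],
          subst mode_lincomb, (auto intro!: continuous_intros)[4],
          subst mode_lincomb, (auto intro!: continuous_intros)[4]) (auto simp: mode_monomials)
    also have "norm \<dots> \<le> 2 * pi * (e / 8 * r)"
    proof (rule mode_norm_le)
      fix t
      show "norm (1 * g (of_real r * cis t) + (-1) * (1 * g 0 + 1 * (A * (of_real r * cis t) + B * cnj (of_real r * cis t)))) \<le> e / 8 * r"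
        using d(2)[of "of_real r * cis t"] r by (simp add: norm_mult algebra_simps)
    qed (use r in \<open>auto intro!: continuous_intros g\<close>)
    finally have 1: "norm (mode j g r - of_real r * ?l) \<le> 2 * pi * (e / 8 * r)" .
    have "mode j g r / of_real r - ?l = (mode j g r - of_real r * ?l) / of_real r"
      using r by (simp add: field_simps)
    then have "norm (mode j g r / of_real r - ?l) \<le> 2 * pi * (e / 8)"
      using 1 r by (simp add: norm_divide field_simps del: if_split)
    also have "\<dots> < e" using pi_less_4 e by simp
    finally show ?thesis by (simp add: dist_norm)
  qed
  then show "\<forall>\<^sub>F r in at_right 0. dist (mode j g r / of_real r) ?l < e"
    unfolding eventually_at_right_field using d(1) by (intro exI[of _ "min d 1"]) auto
qed

text \<open>For \<open>m = 1\<close> this uses continuity of \<open>p\<close> and \<open>q\<close> at the origin, for \<open>m = 2\<close> their differentiability.\<close>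

lemma mode_leading_coefficient:
  fixes m :: nat
  assumes s: "solves_L a b f p q pp pq qq" and m: "m = 1 \<or> m = 2"
  defines "l \<equiv> if m = 1 then p 0 else pp 0"
  shows "((\<lambda>r. mode m (\<lambda>z. z * p z) r / of_real (r ^ m)) \<longlongrightarrow> 2 * of_real pi * l) (at_right 0)"
    and "((\<lambda>r. mode m (\<lambda>z. cnj z * q z) r / of_real (r ^ m)) \<longlongrightarrow> 0) (at_right 0)"
proof -
  note c = solves_L_continuous[OF s]
  have w: "wirt p (pp 0) (pq 0) 0" "wirt q (pq 0) (qq 0) 0"
    using s unfolding solves_L_def by auto
  obtain k where k: "m = Suc k" using m by (cases m) auto
  have "((\<lambda>r. mode k p r / of_real (r ^ k)) \<longlongrightarrow> 2 * of_real pi * l) (at_right 0)"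
    using mode_tendsto_0[OF c(2), of 0] mode_divide_tendsto[OF c(2) w(1), of 1] m k
    by (auto simp: l_def)
  then show "((\<lambda>r. mode m (\<lambda>z. z * p z) r / of_real (r ^ m)) \<longlongrightarrow> 2 * of_real pi * l) (at_right 0)"
    by (rule Lim_transform_eventually)
       (auto simp: k mode_shift eventually_at_right_field intro!: exI[of _ 1])
  have "((\<lambda>r. mode (Suc m) q r / of_real (r ^ k)) \<longlongrightarrow> 0) (at_right 0)"
    using mode_tendsto_0[OF c(3), of 2] mode_divide_tendsto[OF c(3) w(2), of 3] m k
    by (auto simp: numeral_2_eq_2 numeral_3_eq_3)
  then show "((\<lambda>r. mode m (\<lambda>z. cnj z * q z) r / of_real (r ^ m)) \<longlongrightarrow> 0) (at_right 0)"
    by (rule Lim_transform_eventually)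
       (auto simp: k mode_shift eventually_at_right_field intro!: exI[of _ 1])
qed

text \<open>A derivative at the centre is zero exactly when the corresponding mode vanishes near the centre.
  If the derivative is zero, the leading behaviour of the mode system is \<open>o(r\<^sup>m)\<close> and uniqueness for
  the singular system applies. Since \<open>\<rho>\<close> is the same for all solutions, solutions can be compared
  on one circle.\<close>

lemma mode_vanishes_iff:
  fixes m :: nat
  assumes m: "m = 1 \<or> m = 2"
  shows "\<exists>\<rho>. 0 < \<rho> \<and> \<rho> < 1 \<and>
    (\<forall>f p q pp pq qq. solves_L a b f p q pp pq qq \<longrightarrow>
       (\<forall>r\<in>{0<..\<rho>}. mode m f r = 0) \<longleftrightarrow> (if m = 1 then p 0 else pp 0) = 0)"
proof -
  \<comment> \<open>for \<open>r \<le> 1/2\<close> the factor \<open>2 / (1 - r\<^sup>2)\<close> in the system is at most \<open>8/3 \<le> 3\<close>\<close>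
  define K where "K = 3 * (norm a + norm b + norm (a * b))"
  define r0 where "r0 = 1 / (4 * K + 2)"
  have K: "0 \<le> K" by (simp add: K_def)
  then have r0: "0 < r0" "r0 \<le> 1 / 2" "4 * K * r0 \<le> 1"
    unfolding r0_def by (auto simp: field_simps)
  have "(\<forall>r\<in>{0<..r0}. mode m f r = 0) \<longleftrightarrow> (if m = 1 then p 0 else pp 0) = 0"
    if s: "solves_L a b f p q pp pq qq" for f p q pp pq qq
  proof -
    define l where "l = (if m = 1 then p 0 else pp 0)"
    define X where "X = mode m (\<lambda>z. z * p z)"
    define Y where "Y = mode m (\<lambda>z. cnj z * q z)"
    define H where "H = (\<lambda>r. 2 * mode m pq r)"
    note sys = mode_system[OF s, of _ m, folded X_def Y_def]
    have X0: "((\<lambda>r. X r / of_real (r ^ m)) \<longlongrightarrow> 2 * of_real pi * l) (at_right 0)"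
      and Y0: "((\<lambda>r. Y r / of_real (r ^ m)) \<longlongrightarrow> 0) (at_right 0)"
      using mode_leading_coefficient[OF s m] unfolding X_def Y_def l_def .
    show ?thesis unfolding l_def[symmetric]
    proof
      assume z: "\<forall>r\<in>{0<..r0}. mode m f r = 0"
      have "((\<lambda>r. X r / of_real (r ^ m)) \<longlongrightarrow> 0) (at_right 0)"
      proof (rule Lim_transform_eventually[OF Y0])
        have "Y r = X r" if "0 < r" "r < r0" for r
          using sys(3)[of r] z that r0 by auto
        then show "\<forall>\<^sub>F r in at_right 0. Y r / of_real (r ^ m) = X r / of_real (r ^ m)"
          unfolding eventually_at_right_field
          using r0 by (intro exI[of _ r0]) auto
      qed
      then have "2 * of_real pi * l = 0"
        using tendsto_unique[OF _ X0] by simp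
      then show "l = 0" by simp
    next
      assume l: "l = 0"
      have XY: "X r = 0 \<and> Y r = 0" if "0 < r" "r \<le> r0" for r
      proof (rule singular_system_unique[where X=X and Y=Y and H=H and m=m and K=K and \<rho>=r0])
        fix r assume r: "0 < r" "r \<le> r0"
        have r1: "r < 1" using r r0 by simp
        show "(X has_vector_derivative ((of_nat m * X r + of_real (r\<^sup>2) * H r) / of_real r)) (at r)"
          "(Y has_vector_derivative ((- of_nat m * Y r + of_real (r\<^sup>2) * H r) / of_real r)) (at r)"
          using sys(1,2)[OF r(1) r1] unfolding H_def .
        have sq: "r\<^sup>2 \<le> 1 / 4"
          using power_mono[of r "1/2" 2] r r0 by (simp add: power2_eq_square)
        have "norm (mode m f r) \<le> of_nat m * norm (mode m f r)"
          using m by auto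
        also have "\<dots> = norm (X r - Y r)"
          unfolding sys(3)[OF r(1) r1, symmetric] by (simp add: norm_mult)
        also have "\<dots> \<le> norm (X r) + norm (Y r)" by (rule norm_triangle_ineq4)
        finally have f: "norm (mode m f r) \<le> norm (X r) + norm (Y r)" .
        have "3 / 4 * norm (mode m pq r) \<le> norm (1 - of_real (r\<^sup>2) :: complex) * norm (mode m pq r)"
        proof (rule mult_right_mono)
          have "norm (1 - of_real (r\<^sup>2) :: complex) = \<bar>1 - r\<^sup>2\<bar>"
            by (metis norm_of_real of_real_1 of_real_diff)
          then show "3 / 4 \<le> norm (1 - of_real (r\<^sup>2) :: complex)" using sq by simp
        qed simp
        also have "\<dots> = norm (- a * X r - b * Y r + a * b * mode m f r)"
          unfolding sys(4)[OF r(1) r1, symmetric] by (simp add: norm_mult)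
        also have "\<dots> \<le> norm (- a * X r) + norm (b * Y r) + norm (a * b * mode m f r)"
          by (meson norm_triangle_ineq norm_triangle_ineq4 order_trans add_right_mono)
        also have "\<dots> = norm a * norm (X r) + norm b * norm (Y r) + norm (a * b) * norm (mode m f r)"
          by (simp add: norm_mult)
        also have "\<dots> \<le> norm a * (norm (X r) + norm (Y r)) + norm b * (norm (X r) + norm (Y r))
            + norm (a * b) * (norm (X r) + norm (Y r))"
          using f by (intro add_mono mult_left_mono) auto
        also have "\<dots> = K / 3 * (norm (X r) + norm (Y r))"
          by (simp add: K_def algebra_simps)
        finally have "9 / 4 * norm (mode m pq r) \<le> K * (norm (X r) + norm (Y r))" by simp
        then show "norm (H r) \<le> K * (norm (X r) + norm (Y r))"
          unfolding H_def norm_mult norm_numeral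
          using norm_ge_zero[of "mode m pq r"] by linarith
      qed (use X0 Y0 l r0 K that in auto)
      show "\<forall>r\<in>{0<..r0}. mode m f r = 0"
      proof
        fix r assume "r \<in> {0<..r0}"
        then show "mode m f r = 0"
          using sys(3)[of r] XY[of r] r0 m by auto
      qed
    qed
  qed
  then show ?thesis using r0 by (intro exI[of _ r0]) auto
qed

text \<open>By uniqueness the space of possible modes is at most one-dimensional: the mode of any solution is the
  derivative in question times the mode of one reference solution. No reference solution has to be
  constructed; if there is none, the derivative vanishes for all solutions.\<close>

lemma center_coefficient_bound:
  fixes m :: nat
  assumes m: "m = 1 \<or> m = 2"
  shows "\<exists>C\<ge>0. \<forall>f p q pp pq qq B. solves_L a b f p q pp pq qq \<longrightarrow> (\<forall>z\<in>ball 0 1. norm (f z) \<le> B) \<longrightarrow>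
       norm (if m = 1 then p 0 else pp 0) \<le> C * B"
proof -
  obtain r0 where r0: "0 < r0" "r0 < 1"
    and iff: "\<And>f p q pp pq qq. solves_L a b f p q pp pq qq \<Longrightarrow>
       (\<forall>r\<in>{0<..r0}. mode m f r = 0) \<longleftrightarrow> (if m = 1 then p 0 else pp 0) = 0"
    using mode_vanishes_iff[OF m, of a b] by blast
  show ?thesis
  proof (cases "\<exists>f p q pp pq qq. solves_L a b f p q pp pq qq \<and> (if m = 1 then p 0 else pp 0) \<noteq> 0")
    case False
    then show ?thesis by (intro exI[of _ 0]) (metis mult_zero_left norm_zero order_refl)
  next
    case True
    then obtain f' p' q' pp' pq' qq' where s': "solves_L a b f' p' q' pp' pq' qq'"
      and l': "(if m = 1 then p' 0 else pp' 0) \<noteq> 0" by blast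
    define l' where "l' = (if m = 1 then p' 0 else pp' 0)"
    obtain r where r: "r \<in> {0<..r0}" "mode m f' r \<noteq> 0"
      using iff[OF s'] l' by blast
    define C where "C = norm l' * (2 * pi) / norm (mode m f' r)"
    show ?thesis
    proof (intro exI[of _ C] conjI allI impI)
      show "0 \<le> C" by (simp add: C_def)
    next
      fix f p q pp pq qq B
      assume s: "solves_L a b f p q pp pq qq" and B: "\<forall>z\<in>ball 0 1. norm (f z) \<le> B"
      define l where "l = (if m = 1 then p 0 else pp 0)"
      \<comment> \<open>the coefficient is chosen so that the derivative of the combination at the origin is zero\<close>
      have "mode m (\<lambda>z. l' * f z + (- l) * f' z) r = 0"
        using iff[OF solves_L_lincomb[OF s s', of l' "- l"]] r(1) by (auto simp: l_def l'_def)
      then have "l' * mode m f r = l * mode m f' r"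
        using r r0 by (subst (asm) mode_lincomb)
          (auto intro: solves_L_continuous[OF s] solves_L_continuous[OF s'])
      then have "norm l * norm (mode m f' r) = norm l' * norm (mode m f r)"
        by (metis norm_mult)
      also have "\<dots> \<le> norm l' * (2 * pi * B)"
        using r r0 by (intro mult_left_mono mode_norm_le solves_L_continuous[OF s] B[rule_format] circle_in_disc) auto
      finally show "norm (if m = 1 then p 0 else pp 0) \<le> C * B"
        using r(2) unfolding l_def[symmetric] C_def by (simp add: field_simps)
    qed
  qed
qed

lemma center_bound:
  obtains C where "0 \<le> C"
    "\<And>f p q pp pq qq B. solves_L a b f p q pp pq qq \<Longrightarrow> (\<And>z. z \<in> ball 0 1 \<Longrightarrow> norm (f z) \<le> B) \<Longrightarrow>
       norm (p 0) \<le> C * B \<and> norm (q 0) \<le> C * B \<and>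
       norm (pp 0) \<le> C * B \<and> norm (pq 0) \<le> C * B \<and> norm (qq 0) \<le> C * B"
proof -
  obtain C1 where C1: "0 \<le> C1"
    "\<forall>f p q pp pq qq B. solves_L a b f p q pp pq qq \<longrightarrow> (\<forall>z\<in>ball 0 1. norm (f z) \<le> B) \<longrightarrow> norm (p 0) \<le> C1 * B"
    using center_coefficient_bound[of 1 a b] by auto
  obtain C2 where C2: "0 \<le> C2"
    "\<forall>f p q pp pq qq B. solves_L a b f p q pp pq qq \<longrightarrow> (\<forall>z\<in>ball 0 1. norm (f z) \<le> B) \<longrightarrow> norm (pp 0) \<le> C2 * B"
    using center_coefficient_bound[of 2 a b] by auto
  obtain C3 where C3: "0 \<le> C3"
    "\<forall>f p q pp pq qq B. solves_L (cnj b) (cnj a) f p q pp pq qq \<longrightarrow> (\<forall>z\<in>ball 0 1. norm (f z) \<le> B) \<longrightarrow> norm (p 0) \<le> C3 * B"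
    using center_coefficient_bound[of 1 "cnj b" "cnj a"] by auto
  obtain C4 where C4: "0 \<le> C4"
    "\<forall>f p q pp pq qq B. solves_L (cnj b) (cnj a) f p q pp pq qq \<longrightarrow> (\<forall>z\<in>ball 0 1. norm (f z) \<le> B) \<longrightarrow> norm (pp 0) \<le> C4 * B"
    using center_coefficient_bound[of 2 "cnj b" "cnj a"] by auto
  define C where "C = C1 + C2 + C3 + C4 + norm (a * b)"
  have C: "0 \<le> C" "C1 \<le> C" "C2 \<le> C" "C3 \<le> C" "C4 \<le> C" "norm (a * b) \<le> C"
    using C1(1) C2(1) C3(1) C4(1) norm_ge_zero[of "a * b"] unfolding C_def by linarith+
  show thesis
  proof (rule that[OF C(1)])
    fix f p q pp pq qq B
    assume s: "solves_L a b f p q pp pq qq" and B: "\<And>z. z \<in> ball 0 1 \<Longrightarrow> norm (f z) \<le> B"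
    have B0: "0 \<le> B" using B[of 0] norm_ge_zero[of "f 0"] by (auto simp del: norm_ge_zero)
    have "norm (q 0) \<le> C3 * B" "norm (qq 0) \<le> C4 * B"
      using C3(2)[rule_format, OF solves_L_cnj[OF s], of B] C4(2)[rule_format, OF solves_L_cnj[OF s], of B] B by auto
    moreover have "norm (p 0) \<le> C1 * B" "norm (pp 0) \<le> C2 * B"
      using C1(2)[rule_format, OF s B] C2(2)[rule_format, OF s B] by auto
    moreover have "norm (pq 0) \<le> norm (a * b) * B"
    proof -
      have "pq 0 = a * b * f 0" using s unfolding solves_L_def by (auto dest!: bspec[of _ _ 0])
      then show ?thesis using B[of 0] by (auto simp: norm_mult intro!: mult_left_mono)
    qed
    ultimately show "norm (p 0) \<le> C * B \<and> norm (q 0) \<le> C * B \<and>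
       norm (pp 0) \<le> C * B \<and> norm (pq 0) \<le> C * B \<and> norm (qq 0) \<le> C * B"
      using C(2-6) B0 by (meson mult_right_mono order_trans)
  qed
qed

section \<open>Covariance under disc automorphisms\<close>

text \<open>The pointwise algebra behind the covariance of the operator under disc automorphisms, where \<open>W\<close> and
  \<open>C\<close> stand for the conjugates of \<open>w\<close> and \<open>c\<close>. It rests on
  \<open>1 - |z|\<^sup>2 = (1 - |c|\<^sup>2) (1 - |w|\<^sup>2) / |1 + c\<^sup>* w|\<^sup>2\<close>; the exponents of the weight are those for which the
  coefficients of \<open>f\<close>, \<open>f\<^sub>z\<close> and \<open>f\<^sub>w\<close> cancel separately.\<close>

lemma moebius_covariance_identity:
  fixes w W c C a b :: complex
  assumes d: "1 + C * w \<noteq> 0" and e: "1 + c * W \<noteq> 0"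
  defines "s \<equiv> 1 - c * C" and "z \<equiv> (w + c) / (1 + C * w)" and "Z \<equiv> (W + C) / (1 + c * W)"
  defines "h1 \<equiv> b * C / (1 + C * w)" and "h2 \<equiv> a * c / (1 + c * W)"
    and "m \<equiv> s / (1 + C * w)\<^sup>2" and "M \<equiv> s / (1 + c * W)\<^sup>2"
  assumes L: "(1 - z * Z) * fpq + a * z * fp + b * Z * fq - a * b * f = 0"
  shows "(1 - w * W) * (h1 * (h2 * (E * f) + E * M * fq) + h2 * E * m * fp + E * m * M * fpq)
      + a * w * (h1 * (E * f) + E * m * fp) + b * W * (h2 * (E * f) + E * M * fq) - a * b * (E * f) = 0"
proof -
  define d e where "d = 1 + C * w" and "e = 1 + c * W"
  have ne: "d \<noteq> 0" "e \<noteq> 0" using d e by (auto simp: d_def e_def)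
  have 1: "(1 - w * W) * m * M = s / (d * e) * (1 - z * Z)"
  proof -
    have "d * e - (w + c) * (W + C) = s * (1 - w * W)"
      unfolding d_def e_def s_def by (simp add: algebra_simps)
    then have "1 - z * Z = s * (1 - w * W) / (d * e)"
      unfolding z_def Z_def d_def[symmetric] e_def[symmetric] using ne by (simp add: field_simps)
    then show ?thesis
      unfolding m_def M_def d_def[symmetric] e_def[symmetric] using ne
      by (simp add: power2_eq_square mult_ac)
  qed
  have 2: "(1 - z * Z) * fpq = a * b * f - a * z * fp - b * Z * fq"
    using L by (simp add: algebra_simps)
  have cf: "(1 - w * W) * h1 * h2 + s / (d * e) * (a * b) + a * w * h1 + b * W * h2 - a * b = 0"
  proof -
    have "(1 - w * W) * h1 * h2 + s / (d * e) * (a * b) + a * w * h1 + b * W * h2 - a * b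
      = a * b * ((1 - w * W) * c * C + s + w * C * e + W * c * d - d * e) / (d * e)"
      unfolding h1_def h2_def d_def[symmetric] e_def[symmetric] using ne by (simp add: field_simps)
    also have "(1 - w * W) * c * C + s + w * C * e + W * c * d - d * e = 0"
      unfolding d_def e_def s_def by (simp add: algebra_simps)
    finally show ?thesis by simp
  qed
  have cp: "(1 - w * W) * h2 * m - s / (d * e) * (a * z) + a * w * m = 0"
  proof -
    have "(1 - w * W) * h2 * m - s / (d * e) * (a * z) + a * w * m
      = a * s * ((1 - w * W) * c - (w + c) + w * e) / (d\<^sup>2 * e)"
      unfolding h2_def m_def z_def d_def[symmetric] e_def[symmetric] using ne
      by (simp add: field_simps power2_eq_square)
    also have "(1 - w * W) * c - (w + c) + w * e = 0"
      unfolding e_def by (simp add: algebra_simps)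
    finally show ?thesis by simp
  qed
  have cq: "(1 - w * W) * h1 * M - s / (d * e) * (b * Z) + b * W * M = 0"
  proof -
    have "(1 - w * W) * h1 * M - s / (d * e) * (b * Z) + b * W * M
      = b * s * ((1 - w * W) * C - (W + C) + W * d) / (d * e\<^sup>2)"
      unfolding h1_def M_def Z_def d_def[symmetric] e_def[symmetric] using ne
      by (simp add: field_simps power2_eq_square)
    also have "(1 - w * W) * C - (W + C) + W * d = 0"
      unfolding d_def by (simp add: algebra_simps)
    finally show ?thesis by simp
  qed
  have "(1 - w * W) * (h1 * (h2 * (E * f) + E * M * fq) + h2 * E * m * fp + E * m * M * fpq)
      + a * w * (h1 * (E * f) + E * m * fp) + b * W * (h2 * (E * f) + E * M * fq) - a * b * (E * f)
     = E * (f * ((1 - w * W) * h1 * h2 + a * w * h1 + b * W * h2 - a * b)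
        + fp * ((1 - w * W) * h2 * m + a * w * m) + fq * ((1 - w * W) * h1 * M + b * W * M)
        + ((1 - w * W) * m * M) * fpq)"
    by (simp add: algebra_simps)
  also have "((1 - w * W) * m * M) * fpq = s / (d * e) * (a * b * f - a * z * fp - b * Z * fq)"
    unfolding 1 2[symmetric] by (simp only: mult.assoc)
  also have "E * (f * ((1 - w * W) * h1 * h2 + a * w * h1 + b * W * h2 - a * b)
        + fp * ((1 - w * W) * h2 * m + a * w * m) + fq * ((1 - w * W) * h1 * M + b * W * M)
        + s / (d * e) * (a * b * f - a * z * fp - b * Z * fq))
     = E * (f * ((1 - w * W) * h1 * h2 + s / (d * e) * (a * b) + a * w * h1 + b * W * h2 - a * b)
        + fp * ((1 - w * W) * h2 * m - s / (d * e) * (a * z) + a * w * m)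
        + fq * ((1 - w * W) * h1 * M - s / (d * e) * (b * Z) + b * W * M))"
    by (simp only: algebra_simps)
  also have "\<dots> = 0" unfolding cf cp cq by simp
  finally show ?thesis .
qed

lemma moebius_denominator:
  assumes "norm c < 1" "norm w < 1"
  shows "0 < Re (1 + cnj c * w)" and "1 + cnj c * w \<notin> \<real>\<^sub>\<le>\<^sub>0" and "1 + cnj c * w \<noteq> 0"
proof -
  have "norm (cnj c * w) < 1"
    using assms mult_strict_mono'[of "norm c" 1 "norm w" 1] by (simp add: norm_mult)
  then show *: "0 < Re (1 + cnj c * w)"
    using abs_Re_le_cmod[of "cnj c * w"] by simp
  then show "1 + cnj c * w \<notin> \<real>\<^sub>\<le>\<^sub>0" "1 + cnj c * w \<noteq> 0"
    using complex_nonpos_Reals_iff by force+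
qed

lemma moebius_in_disc:
  assumes "norm c < 1" "norm w < 1"
  shows "norm ((w + c) / (1 + cnj c * w)) < 1"
proof -
  have "(norm (1 + cnj c * w))\<^sup>2 - (norm (w + c))\<^sup>2 = (1 - (norm c)\<^sup>2) * (1 - (norm w)\<^sup>2)"
    unfolding cmod_power2 by (simp add: algebra_simps power2_eq_square)
  moreover have "0 < (1 - (norm c)\<^sup>2) * (1 - (norm w)\<^sup>2)"
    using assms by (simp add: power_less_one_iff)
  ultimately have "(norm (w + c))\<^sup>2 < (norm (1 + cnj c * w))\<^sup>2" by simp
  then have "norm (w + c) < norm (1 + cnj c * w)"
    by (rule power2_less_imp_less) simp
  then show ?thesis
    using moebius_denominator(3)[OF assms] by (simp add: norm_divide)
qed

lemma DERIV_const_divide: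
  fixes g :: "complex \<Rightarrow> complex"
  assumes "(g has_field_derivative g') (at z)" "g z \<noteq> 0"
  shows "((\<lambda>w. k / g w) has_field_derivative - k * g' / (g z)\<^sup>2) (at z)"
    and "((\<lambda>w. k / (g w)\<^sup>2) has_field_derivative - 2 * g' / g z * (k / (g z)\<^sup>2)) (at z)"
  using assms by (auto intro!: derivative_eq_intros simp: field_simps power2_eq_square)

text \<open>The function \<open>(1 + c\<^sup>* w)\<^sup>b (1 + c w\<^sup>*)\<^sup>a f((w + c) / (1 + c\<^sup>* w))\<close> is again a solution, and its value at the
  origin is \<open>f(c)\<close>. In this way estimates at the origin give estimates at every point of the disc.\<close>

lemma solves_L_moebius:
  fixes a b c :: complex
  assumes s: "solves_L a b f p q pp pq qq" and c: "norm c < 1"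
  defines "\<phi> \<equiv> \<lambda>w. (w + c) / (1 + cnj c * w)"
    and "m \<equiv> \<lambda>w. (1 - c * cnj c) / (1 + cnj c * w)\<^sup>2"
    and "h1 \<equiv> \<lambda>w. b * cnj c / (1 + cnj c * w)"
    and "h2 \<equiv> \<lambda>w. a * c / (1 + c * cnj w)"
    and "E \<equiv> \<lambda>w. (1 + cnj c * w) powr b * cnj ((1 + cnj c * w) powr cnj a)"
  defines "P \<equiv> \<lambda>w. h1 w * (E w * f (\<phi> w)) + E w * m w * p (\<phi> w)"
    and "Q \<equiv> \<lambda>w. h2 w * (E w * f (\<phi> w)) + E w * cnj (m w) * q (\<phi> w)"
  shows "solves_L a b (\<lambda>w. E w * f (\<phi> w)) P Q
    (\<lambda>w. - b * (cnj c)\<^sup>2 / (1 + cnj c * w)\<^sup>2 * (E w * f (\<phi> w)) + h1 w * P w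
        + (h1 w - 2 * cnj c / (1 + cnj c * w)) * E w * m w * p (\<phi> w) + E w * (m w)\<^sup>2 * pp (\<phi> w))
    (\<lambda>w. h1 w * Q w + h2 w * E w * m w * p (\<phi> w) + E w * m w * cnj (m w) * pq (\<phi> w))
    (\<lambda>w. - a * c\<^sup>2 / (1 + c * cnj w)\<^sup>2 * (E w * f (\<phi> w)) + h2 w * Q w
        + (h2 w - 2 * c / (1 + c * cnj w)) * E w * cnj (m w) * q (\<phi> w) + E w * (cnj (m w))\<^sup>2 * qq (\<phi> w))"
proof -
  let ?D = "ball (0::complex) 1"
  note ct = solves_L_continuous[OF s]
  have ct2: "continuous_on ?D pp" "continuous_on ?D pq" "continuous_on ?D qq"
    and w: "\<And>z. z \<in> ?D \<Longrightarrow> wirt f (p z) (q z) z"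
       "\<And>z. z \<in> ?D \<Longrightarrow> wirt p (pp z) (pq z) z"
       "\<And>z. z \<in> ?D \<Longrightarrow> wirt q (pq z) (qq z) z"
    and L: "\<And>z. z \<in> ?D \<Longrightarrow>
      (1 - of_real ((cmod z)\<^sup>2)) * pq z + a * z * p z + b * cnj z * q z - a * b * f z = 0"
    using s unfolding solves_L_def by auto
  have d0: "1 + cnj c * z \<noteq> 0" "1 + cnj c * z \<notin> \<real>\<^sub>\<le>\<^sub>0" "1 + c * cnj z \<noteq> 0" if "z \<in> ?D" for z
    using moebius_denominator[OF c, of z] that
    by (auto simp flip: complex_cnj_cancel_iff[of "1 + c * cnj z"])
  have \<phi>D: "\<phi> z \<in> ?D" if "z \<in> ?D" for z
    using moebius_in_disc[OF c, of z] that by (simp add: \<phi>_def)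
  have dd: "((\<lambda>w. 1 + cnj c * w) has_field_derivative cnj c) (at z)" for z
    by (auto intro!: derivative_eq_intros)
  have d\<phi>: "(\<phi> has_field_derivative m z) (at z)" if "z \<in> ?D" for z
    unfolding \<phi>_def m_def using d0[OF that]
    by (auto intro!: derivative_eq_intros simp: field_simps power2_eq_square)
  have wE: "wirt E (h1 z * E z) (h2 z * E z) z" if z: "z \<in> ?D" for z
  proof -
    have *: "((\<lambda>w. (1 + cnj c * w) powr x) has_field_derivative x * cnj c / (1 + cnj c * z) * (1 + cnj c * z) powr x) (at z)" for x
      using d0[OF z] by (auto intro!: derivative_eq_intros simp: powr_diff field_simps)
    show ?thesis unfolding E_def h1_def h2_def
      by (rule wirt_eq_rhs[OF wirt_mult[OF wirt_holomorphic[OF *] wirt_cnj[OF wirt_holomorphic[OF *]]]])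
         (auto simp: algebra_simps)
  qed
  have wm: "wirt m (- 2 * cnj c / (1 + cnj c * z) * m z) 0 z" if z: "z \<in> ?D" for z
    unfolding m_def by (intro wirt_holomorphic DERIV_const_divide(2) dd d0(1)[OF z])
  have wh1: "wirt h1 (- b * (cnj c)\<^sup>2 / (1 + cnj c * z)\<^sup>2) 0 z" if z: "z \<in> ?D" for z
    using wirt_holomorphic[OF DERIV_const_divide(1)[OF dd d0(1)[OF z]], of "b * cnj c"]
    by (simp add: h1_def[abs_def] power2_eq_square mult_ac)
  have wh2: "wirt h2 0 (- a * c\<^sup>2 / (1 + c * cnj z)\<^sup>2) z" if z: "z \<in> ?D" for z
    using wirt_cnj[OF wirt_holomorphic[OF DERIV_const_divide(1)[OF dd d0(1)[OF z]]], of "cnj a * cnj c"]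
    by (simp add: h2_def[abs_def] power2_eq_square mult_ac)
  have wc: "wirt (\<lambda>w. g (\<phi> w)) (A * m z) (B * cnj (m z)) z" if "z \<in> ?D" "wirt g A B (\<phi> z)" for g A B z
    by (rule wirt_compose_holomorphic[OF that(2) d\<phi>[OF that(1)]])
  have wv: "wirt (\<lambda>w. E w * f (\<phi> w)) (P z) (Q z) z" if z: "z \<in> ?D" for z
    unfolding P_def Q_def
    by (rule wirt_eq_rhs[OF wirt_mult[OF wE[OF z] wc[OF z w(1)[OF \<phi>D[OF z]]]]]) (simp_all add: algebra_simps)
  have wP: "wirt P (- b * (cnj c)\<^sup>2 / (1 + cnj c * z)\<^sup>2 * (E z * f (\<phi> z)) + h1 z * P z
        + (h1 z - 2 * cnj c / (1 + cnj c * z)) * E z * m z * p (\<phi> z) + E z * (m z)\<^sup>2 * pp (\<phi> z))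
      (h1 z * Q z + h2 z * E z * m z * p (\<phi> z) + E z * m z * cnj (m z) * pq (\<phi> z)) z" if z: "z \<in> ?D" for z
    unfolding P_def[abs_def]
    apply (rule wirt_eq_rhs[OF wirt_add[OF wirt_mult[OF wh1[OF z] wv[OF z]]
         wirt_mult[OF wirt_mult[OF wE[OF z] wm[OF z]] wc[OF z w(2)[OF \<phi>D[OF z]]]]]])
    unfolding P_def Q_def
    by (simp_all add: algebra_simps power2_eq_square)
  have wQ: "wirt Q (h1 z * Q z + h2 z * E z * m z * p (\<phi> z) + E z * m z * cnj (m z) * pq (\<phi> z))
      (- a * c\<^sup>2 / (1 + c * cnj z)\<^sup>2 * (E z * f (\<phi> z)) + h2 z * Q z
        + (h2 z - 2 * c / (1 + c * cnj z)) * E z * cnj (m z) * q (\<phi> z) + E z * (cnj (m z))\<^sup>2 * qq (\<phi> z)) z" if z: "z \<in> ?D" for z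
    unfolding Q_def[abs_def]
    apply (rule wirt_eq_rhs[OF wirt_add[OF wirt_mult[OF wh2[OF z] wv[OF z]]
         wirt_mult[OF wirt_mult[OF wE[OF z] wirt_cnj[OF wm[OF z]]] wc[OF z w(3)[OF \<phi>D[OF z]]]]]])
    unfolding P_def Q_def
    by (simp_all add: algebra_simps power2_eq_square)
  have cE: "continuous_on ?D E"
    by (intro continuous_at_imp_continuous_on ballI wirt_continuous[OF wE])
  have cm: "continuous_on ?D m"
    by (intro continuous_at_imp_continuous_on ballI wirt_continuous[OF wm])
  have ch: "continuous_on ?D h1" "continuous_on ?D h2"
    using wirt_continuous[OF wh1] wirt_continuous[OF wh2] by (auto intro: continuous_at_imp_continuous_on)
  have cP: "continuous_on ?D P" "continuous_on ?D Q" 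
    using wirt_continuous[OF wP] wirt_continuous[OF wQ] by (auto intro: continuous_at_imp_continuous_on)
  have c\<phi>: "continuous_on ?D \<phi>"
    by (intro continuous_at_imp_continuous_on ballI DERIV_isCont[OF d\<phi>])
  have cc: "continuous_on ?D (\<lambda>w. g (\<phi> w))" if "continuous_on ?D g" for g
    by (rule continuous_on_compose2[OF that c\<phi>]) (use \<phi>D in auto)
  show ?thesis
    unfolding solves_L_def
  proof (intro conjI ballI wv wP wQ)
    fix z :: complex assume z: "z \<in> ?D"
    have [simp]: "cnj (m z) = (1 - c * cnj c) / (1 + c * cnj z)\<^sup>2" by (simp add: m_def mult.commute)
    have "(1 - \<phi> z * cnj (\<phi> z)) * pq (\<phi> z) + a * \<phi> z * p (\<phi> z) + b * cnj (\<phi> z) * q (\<phi> z) - a * b * f (\<phi> z) = 0"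
      using L[OF \<phi>D[OF z]] by (simp only: complex_norm_square)
    moreover have "cnj (\<phi> z) = (cnj z + cnj c) / (1 + c * cnj z)" by (simp add: \<phi>_def)
    ultimately have L': "(1 - \<phi> z * ((cnj z + cnj c) / (1 + c * cnj z))) * pq (\<phi> z) + a * \<phi> z * p (\<phi> z)
        + b * ((cnj z + cnj c) / (1 + c * cnj z)) * q (\<phi> z) - a * b * f (\<phi> z) = 0" by simp
    have "(1 - z * cnj z) * (h1 z * Q z + h2 z * E z * m z * p (\<phi> z) + E z * m z * cnj (m z) * pq (\<phi> z))
       + a * z * P z + b * cnj z * Q z - a * b * (E z * f (\<phi> z)) = 0"
      unfolding P_def Q_def h1_def h2_def \<open>cnj (m z) = _\<close> unfolding m_def
      by (rule moebius_covariance_identity[OF d0(1)[OF z] d0(3)[OF z]]) (use L' in \<open>simp only: \<phi>_def\<close>)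
    then show "(1 - of_real ((cmod z)\<^sup>2)) * (h1 z * Q z + h2 z * E z * m z * p (\<phi> z) + E z * m z * cnj (m z) * pq (\<phi> z))
       + a * z * P z + b * cnj z * Q z - a * b * (E z * f (\<phi> z)) = 0"
      by (simp only: complex_norm_square)
  qed (use d0 in \<open>auto intro!: continuous_intros cE cm ch cP cc ct ct2\<close>)
qed

section \<open>Interior estimates in one variable\<close>

text \<open>The points \<open>1 + c\<^sup>* w\<close> stay in a compact subset of the right half plane, away from the branch cut.\<close>

lemma moebius_weight_bounded:
  assumes R: "R < 1"
  shows "\<exists>M\<ge>0. \<forall>c w. norm c \<le> R \<longrightarrow> norm w < 1 \<longrightarrow> norm ((1 + cnj c * w) powr x) \<le> M"
proof -
  define S where "S = {z. 1 - R \<le> Re z} \<inter> cball 0 2"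
  have "compact S"
    unfolding S_def by (intro closed_Int_compact closed_halfspace_Re_ge compact_cball)
  moreover have "continuous_on S (\<lambda>z. z powr x)"
    by (intro continuous_intros) (use R in \<open>auto simp: S_def\<close>)
  ultimately have "bounded ((\<lambda>z. z powr x) ` S)"
    by (intro compact_imp_bounded compact_continuous_image)
  then obtain M where M: "0 < M" "\<And>z. z \<in> S \<Longrightarrow> norm (z powr x) \<le> M"
    unfolding bounded_pos by auto
  have "1 + cnj c * w \<in> S" if "norm c \<le> R" "norm w < 1" for c w
  proof -
    have "norm (cnj c * w) \<le> R * 1"
      unfolding norm_mult using that by (intro mult_mono) (auto intro: order_trans[OF norm_ge_zero])
    then show ?thesis
      using abs_Re_le_cmod[of "cnj c * w"] norm_triangle_ineq[of 1 "cnj c * w"] R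
      unfolding S_def by auto
  qed
  with M show ?thesis by (intro exI[of _ M]) auto
qed

text \<open>An interior estimate: on the disc of radius \<open>R\<close> all derivatives of order one and two of a solution
  are controlled by the supremum of the solution.\<close>

definition derivative_bound :: "complex \<Rightarrow> complex \<Rightarrow> real \<Rightarrow> real \<Rightarrow> bool"
  where "derivative_bound a b R C \<longleftrightarrow> 0 \<le> C \<and>
    (\<forall>f p q pp pq qq B c. solves_L a b f p q pp pq qq \<longrightarrow> (\<forall>z\<in>ball 0 1. norm (f z) \<le> B) \<longrightarrow>
       norm c \<le> R \<longrightarrow> norm (p c) \<le> C * B \<and> norm (q c) \<le> C * B \<and>
       norm (pp c) \<le> C * B \<and> norm (pq c) \<le> C * B \<and> norm (qq c) \<le> C * B)"

lemma derivative_boundD: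
  assumes "derivative_bound a b R C" "solves_L a b f p q pp pq qq"
    and "\<And>z. z \<in> ball 0 1 \<Longrightarrow> norm (f z) \<le> B" "norm c \<le> R"
  shows "norm (p c) \<le> C * B" "norm (q c) \<le> C * B"
    "norm (pp c) \<le> C * B" "norm (pq c) \<le> C * B" "norm (qq c) \<le> C * B"
  using assms unfolding derivative_bound_def by blast+

text \<open>Transport a point \<open>c\<close> to the origin by the automorphism and solve the formulas for the derivatives
  of the transformed solution at the origin for the derivatives at \<open>c\<close>; the Jacobian
  \<open>1 - |c|\<^sup>2\<close> by which one has to divide is at least \<open>1 - R\<^sup>2\<close>.\<close>

lemma interior_bound:
  assumes R: "R < 1"
  shows "\<exists>C. derivative_bound a b R C"
proof (cases "0 \<le> R")
  case False
  then have "\<not> norm c \<le> R" for c :: complex by (meson norm_ge_zero order_trans)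
  then show ?thesis by (intro exI[of _ 0]) (auto simp: derivative_bound_def)
next
  case R0: True
  obtain M1 where M1: "0 \<le> M1"
    "\<And>c w. norm c \<le> R \<Longrightarrow> norm w < 1 \<Longrightarrow> norm ((1 + cnj c * w) powr b) \<le> M1"
    using moebius_weight_bounded[OF R, of b] by blast
  obtain M2 where M2: "0 \<le> M2"
    "\<And>c w. norm c \<le> R \<Longrightarrow> norm w < 1 \<Longrightarrow> norm ((1 + cnj c * w) powr cnj a) \<le> M2"
    using moebius_weight_bounded[OF R, of "cnj a"] by blast
  obtain C0 where C0: "0 \<le> C0"
    "\<And>f p q pp pq qq B. solves_L a b f p q pp pq qq \<Longrightarrow> (\<And>z. z \<in> ball 0 1 \<Longrightarrow> norm (f z) \<le> B) \<Longrightarrow>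
       norm (p 0) \<le> C0 * B \<and> norm (q 0) \<le> C0 * B \<and>
       norm (pp 0) \<le> C0 * B \<and> norm (pq 0) \<le> C0 * B \<and> norm (qq 0) \<le> C0 * B"
    by (rule center_bound[of a b]) blast
  define K where "K = C0 * (M1 * M2)"
  define A where "A = norm a + norm b"
  define \<sigma> where "\<sigma> = 1 - R\<^sup>2"
  define C1 where "C1 = (K + A) / \<sigma>"
  define C2 where "C2 = (K + A + A * K + (A + 2) * (K + A)) / \<sigma>\<^sup>2"
  have \<sigma>: "0 < \<sigma>" "\<sigma> \<le> 1" using R R0 by (auto simp: \<sigma>_def power_less_one_iff abs_square_less_1)
  have K: "0 \<le> K" and A: "0 \<le> A" "norm a \<le> A" "norm b \<le> A"
    using C0(1) M1(1) M2(1) by (auto simp: K_def A_def)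
  have C1: "0 \<le> C1" using K A \<sigma> by (simp add: C1_def)
  then have C2: "0 \<le> C2" using K A \<sigma> by (simp add: C2_def)
  show ?thesis
    unfolding derivative_bound_def
  proof (intro exI[of _ "C1 + C2"] conjI allI impI)
    show "0 \<le> C1 + C2" using C1 C2 by simp
    fix f p q pp pq qq :: "complex \<Rightarrow> complex" and B :: real and c :: complex
    assume s: "solves_L a b f p q pp pq qq" and B: "\<forall>z\<in>ball 0 1. norm (f z) \<le> B" and c: "norm c \<le> R"
    have c1: "norm c < 1" using c R by simp
    have B0: "0 \<le> B" using B[rule_format, of 0] norm_ge_zero[of "f 0"] by (auto simp del: norm_ge_zero)
    have fc: "norm (f c) \<le> B" using B c1 by auto
    define \<tau> where "\<tau> = 1 - c * cnj c"
    have \<tau>: "\<sigma> \<le> norm \<tau>"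
    proof -
      have "\<tau> = of_real (1 - (norm c)\<^sup>2)"
        unfolding \<tau>_def of_real_diff complex_norm_square by simp
      then have "norm \<tau> = \<bar>1 - (norm c)\<^sup>2\<bar>" by (metis norm_of_real)
      moreover have "(norm c)\<^sup>2 \<le> R\<^sup>2" using c by (intro power_mono) auto
      ultimately show ?thesis by (simp add: \<sigma>_def)
    qed
    \<comment> \<open>\<open>P0\<close> and \<open>Q0\<close> are the first derivatives of the transformed solution at the origin\<close>
    define P0 where "P0 = b * cnj c * f c + \<tau> * p c"
    define Q0 where "Q0 = a * c * f c + \<tau> * q c"
    have bound: "norm P0 \<le> K * B \<and> norm Q0 \<le> K * B \<and>
       norm (- b * (cnj c)\<^sup>2 * f c + b * cnj c * P0 + (b * cnj c - 2 * cnj c) * \<tau> * p c + \<tau>\<^sup>2 * pp c) \<le> K * B \<and>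
       norm (b * cnj c * Q0 + a * c * \<tau> * p c + \<tau>\<^sup>2 * pq c) \<le> K * B \<and>
       norm (- a * c\<^sup>2 * f c + a * c * Q0 + (a * c - 2 * c) * \<tau> * q c + \<tau>\<^sup>2 * qq c) \<le> K * B"
    proof -
      have "norm ((1 + cnj c * w) powr b * cnj ((1 + cnj c * w) powr cnj a) * f ((w + c) / (1 + cnj c * w))) \<le> M1 * M2 * B"
        if "w \<in> ball 0 1" for w
        unfolding norm_mult complex_mod_cnj
        using M1 M2 B moebius_in_disc[OF c1, of w] c that B0
        by (intro mult_mono) auto
      from C0(2)[OF solves_L_moebius[OF s c1] this] show ?thesis
        by (simp add: P0_def Q0_def \<tau>_def K_def mult_ac power2_eq_square)
    qed
    have cc: "norm (cnj c) \<le> 1" "norm c \<le> 1" using c1 by auto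
    have mul: "norm (x * y * z) \<le> X * Z" if "norm x \<le> X" "norm y \<le> 1" "norm z \<le> Z" for x y z :: complex and X Z
    proof -
      have "norm x * norm y * norm z \<le> X * 1 * Z"
        using that by (intro mult_mono) (auto intro: order_trans[OF norm_ge_zero] mult_nonneg_nonneg)
      then show ?thesis by (simp add: norm_mult)
    qed
    have quot: "norm x \<le> Z / \<sigma>" if "norm (\<tau> * x) \<le> Z" for x Z
    proof -
      have "\<sigma> * norm x \<le> norm \<tau> * norm x" using \<tau> by (intro mult_right_mono) auto
      then show ?thesis using that \<sigma> by (simp add: norm_mult field_simps)
    qed
    have quot2: "norm x \<le> Z / \<sigma>\<^sup>2" if "norm (\<tau>\<^sup>2 * x) \<le> Z" for x Z
      using quot[OF quot[of "\<tau> * x" Z]] that by (simp add: power2_eq_square mult.assoc)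
    have "norm (P0 - b * cnj c * f c) \<le> K * B + A * B" "norm (Q0 - a * c * f c) \<le> K * B + A * B"
      using bound by (intro order_trans[OF norm_triangle_ineq4] add_mono mul A cc fc; simp)+
    then have tp: "norm (\<tau> * p c) \<le> (K + A) * B" and tq: "norm (\<tau> * q c) \<le> (K + A) * B"
      by (simp_all add: P0_def Q0_def algebra_simps)
    have p: "norm (p c) \<le> C1 * B" "norm (q c) \<le> C1 * B"
      using quot[OF tp] quot[OF tq] by (simp_all add: C1_def)
    have n4: "norm (t + x - y - z) \<le> T + X + Y + Z"
      if "norm t \<le> T" "norm x \<le> X" "norm y \<le> Y" "norm z \<le> Z" for t x y z :: complex and T X Y Z
      by (intro order_trans[OF norm_triangle_ineq4] order_trans[OF norm_triangle_ineq] add_mono that)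
    have cf: "norm (cnj c * f c) \<le> B" "norm (c * f c) \<le> B"
      using mult_mono[OF cc(2) fc] B0 by (simp_all add: norm_mult)
    have a2: "norm (b - 2) \<le> A + 2" "norm (a - 2) \<le> A + 2"
      using norm_triangle_ineq4[of b 2] norm_triangle_ineq4[of a 2] A by auto
    have C2B: "C2 * B = (K * B + A * B + A * (K * B) + (A + 2) * ((K + A) * B)) / \<sigma>\<^sup>2"
      by (simp add: C2_def algebra_simps add_divide_distrib)
    have P0: "norm P0 \<le> K * B" and Q0: "norm Q0 \<le> K * B" using bound by auto
    have "norm ((- b * (cnj c)\<^sup>2 * f c + b * cnj c * P0 + (b * cnj c - 2 * cnj c) * \<tau> * p c + \<tau>\<^sup>2 * pp c)
        + b * cnj c * (cnj c * f c) - b * cnj c * P0 - (b - 2) * cnj c * (\<tau> * p c))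
        \<le> K * B + A * B + A * (K * B) + (A + 2) * ((K + A) * B)"
      by (intro n4 mul A cc cf P0 tp a2) (use bound in blast)
    also have "(- b * (cnj c)\<^sup>2 * f c + b * cnj c * P0 + (b * cnj c - 2 * cnj c) * \<tau> * p c + \<tau>\<^sup>2 * pp c)
        + b * cnj c * (cnj c * f c) - b * cnj c * P0 - (b - 2) * cnj c * (\<tau> * p c) = \<tau>\<^sup>2 * pp c"
      by (simp add: algebra_simps power2_eq_square)
    finally have pp: "norm (pp c) \<le> C2 * B" unfolding C2B by (rule quot2)
    have "norm ((- a * c\<^sup>2 * f c + a * c * Q0 + (a * c - 2 * c) * \<tau> * q c + \<tau>\<^sup>2 * qq c)
        + a * c * (c * f c) - a * c * Q0 - (a - 2) * c * (\<tau> * q c))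
        \<le> K * B + A * B + A * (K * B) + (A + 2) * ((K + A) * B)"
      by (intro n4 mul A cc cf Q0 tq a2) (use bound in blast)
    also have "(- a * c\<^sup>2 * f c + a * c * Q0 + (a * c - 2 * c) * \<tau> * q c + \<tau>\<^sup>2 * qq c)
        + a * c * (c * f c) - a * c * Q0 - (a - 2) * c * (\<tau> * q c) = \<tau>\<^sup>2 * qq c"
      by (simp add: algebra_simps power2_eq_square)
    finally have qq: "norm (qq c) \<le> C2 * B" unfolding C2B by (rule quot2)
    have "norm ((b * cnj c * Q0 + a * c * \<tau> * p c + \<tau>\<^sup>2 * pq c) + 0 - b * cnj c * Q0 - a * c * (\<tau> * p c))
        \<le> K * B + A * B + A * (K * B) + (A + 2) * ((K + A) * B)"
    proof (intro n4 mul A cc Q0 tp)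
      show "norm (0::complex) \<le> A * B" using A B0 by simp
      show "norm a \<le> A + 2" using A by simp
    qed (use bound in blast)
    also have "(b * cnj c * Q0 + a * c * \<tau> * p c + \<tau>\<^sup>2 * pq c) + 0 - b * cnj c * Q0 - a * c * (\<tau> * p c) = \<tau>\<^sup>2 * pq c"
      by simp
    finally have pq: "norm (pq c) \<le> C2 * B" unfolding C2B by (rule quot2)
    have "C1 * B \<le> (C1 + C2) * B" "C2 * B \<le> (C1 + C2) * B"
      using C1 C2 B0 by (auto intro: mult_right_mono)
    with p pp pq qq show "norm (p c) \<le> (C1 + C2) * B" "norm (q c) \<le> (C1 + C2) * B"
       "norm (pp c) \<le> (C1 + C2) * B" "norm (pq c) \<le> (C1 + C2) * B" "norm (qq c) \<le> (C1 + C2) * B"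
      by linarith+
  qed
qed

section \<open>Differentiability and commuting derivatives in one variable\<close>

lemma continuous_on_Complex:
  fixes f g :: "'a::topological_space \<Rightarrow> real"
  assumes "continuous_on S f" "continuous_on S g"
  shows "continuous_on S (\<lambda>x. Complex (f x) (g x))"
  unfolding Complex_eq by (intro continuous_intros assms)

lemma small_box_in_ball:
  assumes z: "z \<in> ball (0::complex) 1"
  obtains d where "0 < d" "\<And>x y. \<bar>x - Re z\<bar> < d \<Longrightarrow> \<bar>y - Im z\<bar> < d \<Longrightarrow> Complex x y \<in> ball 0 1"
proof -
  define d where "d = (1 - norm z) / 2"
  have "Complex x y \<in> ball 0 1" if "\<bar>x - Re z\<bar> < d" "\<bar>y - Im z\<bar> < d" for x y
  proof -
    have "norm (Complex x y) \<le> norm z + norm (Complex x y - z)"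
      using norm_triangle_ineq[of z "Complex x y - z"] by simp
    also have "norm (Complex x y - z) \<le> \<bar>x - Re z\<bar> + \<bar>y - Im z\<bar>"
      using cmod_le[of "Complex x y - z"] by simp
    also have "\<dots> < 1 - norm z" using that by (simp add: d_def)
    finally show ?thesis by simp
  qed
  then show thesis using z by (intro that[of d]) (auto simp: d_def)
qed

text \<open>Continuity of one of two partial derivatives is enough for differentiability.\<close>

lemma wirt_of_partials:
  fixes f fx fy :: "complex \<Rightarrow> complex"
  assumes fx: "\<And>z. z \<in> ball 0 1 \<Longrightarrow> ((\<lambda>t. f (z + of_real t)) has_vector_derivative fx z) (at 0)"
    and fy: "\<And>z. z \<in> ball 0 1 \<Longrightarrow> ((\<lambda>t. f (z + of_real t * \<i>)) has_vector_derivative fy z) (at 0)"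
    and c: "continuous_on (ball 0 1) fy" and z: "z \<in> ball 0 1"
  shows "wirt f ((fx z - \<i> * fy z) / 2) ((fx z + \<i> * fy z) / 2) z"
proof -
  obtain d where d: "0 < d" "\<And>x y. \<bar>x - Re z\<bar> < d \<Longrightarrow> \<bar>y - Im z\<bar> < d \<Longrightarrow> Complex x y \<in> ball 0 1"
    using small_box_in_ball[OF z] by blast
  let ?X = "{Re z - d<..<Re z + d}" and ?Y = "{Im z - d<..<Im z + d}"
  have box: "Complex x y \<in> ball 0 1" if "x \<in> ?X" "y \<in> ?Y" for x y
    using that by (intro d(2)) (auto simp: abs_less_iff)
  have 1: "((\<lambda>x. f (Complex x y)) has_vector_derivative fx (Complex x y)) (at x)"
    if "Complex x y \<in> ball 0 1" for x y
  proof -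
    have "((\<lambda>t. f (Complex x y + of_real (t - x))) has_vector_derivative 1 *\<^sub>R fx (Complex x y)) (at x)"
      using fx[OF that]
      by (intro vector_diff_chain_at[of "\<lambda>t. t - x" 1 x "\<lambda>s. f (Complex x y + of_real s)", unfolded o_def])
         (auto intro!: derivative_eq_intros)
    moreover have "Complex x y + of_real (t - x) = Complex t y" for t
      by (simp add: complex_eq_iff)
    ultimately show ?thesis by simp
  qed
  have 2: "((\<lambda>y. f (Complex x y)) has_vector_derivative fy (Complex x y)) (at y)"
    if "Complex x y \<in> ball 0 1" for x y
  proof -
    have "((\<lambda>t. f (Complex x y + of_real (t - y) * \<i>)) has_vector_derivative 1 *\<^sub>R fy (Complex x y)) (at y)"
      using fy[OF that]
      by (intro vector_diff_chain_at[of "\<lambda>t. t - y" 1 y "\<lambda>s. f (Complex x y + of_real s * \<i>)", unfolded o_def])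
         (auto intro!: derivative_eq_intros)
    moreover have "Complex x y + of_real (t - y) * \<i> = Complex x t" for t
      by (simp add: complex_eq_iff)
    ultimately show ?thesis by simp
  qed
  have in_box: "Re z \<in> ?X" "Im z \<in> ?Y" using d(1) by auto
  have "((\<lambda>(x, y). f (Complex x y)) has_derivative
      (\<lambda>(tx, ty). tx *\<^sub>R fx z + blinfun_apply (blinfun_scaleR_left (fy (Complex (Re z) (Im z)))) ty))
      (at (Re z, Im z) within ?X \<times> ?Y)"
  proof (rule has_derivative_partialsI[where fy="\<lambda>x y. blinfun_scaleR_left (fy (Complex x y))"])
    show "((\<lambda>x. f (Complex x (Im z))) has_derivative (\<lambda>tx. tx *\<^sub>R fx z)) (at (Re z) within ?X)"
      using 1[of "Re z" "Im z"] z unfolding has_vector_derivative_def by (auto intro: has_derivative_at_withinI)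
    show "((\<lambda>y. f (Complex x y)) has_derivative blinfun_apply (blinfun_scaleR_left (fy (Complex x y)))) (at y within ?Y)"
      if "x \<in> ?X" "y \<in> ?Y" for x y
      using 2[OF box[OF that]] unfolding has_vector_derivative_def by (auto intro: has_derivative_at_withinI)
    have "continuous_on (?X \<times> ?Y) (\<lambda>(x, y). blinfun_scaleR_left (fy (Complex x y)))"
      unfolding case_prod_beta
      by (intro continuous_intros continuous_on_Complex continuous_on_compose2[OF c])
         (use box in auto)
    then show "continuous (at (Re z, Im z) within ?X \<times> ?Y) (\<lambda>(x, y). blinfun_scaleR_left (fy (Complex x y)))"
      unfolding continuous_on_eq_continuous_within by (rule bspec) (use in_box in simp)
  qed (use in_box in auto)
  moreover have "at (Re z, Im z) within ?X \<times> ?Y = at (Re z, Im z)"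
    by (rule at_within_open[OF SigmaI[OF in_box] open_Times[OF open_greaterThanLessThan open_greaterThanLessThan]])
  ultimately have F: "((\<lambda>(x, y). f (Complex x y)) has_derivative (\<lambda>(tx, ty). tx *\<^sub>R fx z + ty *\<^sub>R fy z)) (at (Re z, Im z))"
    by (simp only: blinfun_scaleR_left.rep_eq complex_surj complex.collapse)
  have "((\<lambda>w. (Re w, Im w)) has_derivative (\<lambda>w. (Re w, Im w))) (at z)"
    by (intro has_derivative_Pair bounded_linear.has_derivative[OF bounded_linear_Re has_derivative_ident]
        bounded_linear.has_derivative[OF bounded_linear_Im has_derivative_ident])
  from has_derivative_compose[OF this F]
  have "(f has_derivative (\<lambda>h. Re h *\<^sub>R fx z + Im h *\<^sub>R fy z)) (at z)" by simp
  moreover have "Re h *\<^sub>R fx z + Im h *\<^sub>R fy z = (fx z - \<i> * fy z) / 2 * h + (fx z + \<i> * fy z) / 2 * cnj h" for h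
  proof -
    have "(fx z - \<i> * fy z) / 2 * h + (fx z + \<i> * fy z) / 2 * cnj h
       = fx z * ((h + cnj h) / 2) - \<i> * fy z * ((h - cnj h) / 2)"
      by (simp add: algebra_simps add_divide_distrib diff_divide_distrib)
    then show ?thesis
      by (simp add: complex_add_cnj complex_diff_cnj scaleR_conv_of_real algebra_simps)
  qed
  ultimately show ?thesis unfolding wirt_def by simp
qed

text \<open>Schwarz's theorem, by differentiating \<open>f(x, y) - f(x\<^sub>0, y) = \<integral> f\<^sub>x(t, y) dt\<close> under the integral
  sign with respect to \<open>y\<close> and then with respect to the upper limit \<open>x\<close>.\<close>

lemma mixed_wirt_derivatives_commute:
  assumes f: "\<And>z. z \<in> ball 0 1 \<Longrightarrow> wirt f (p z) (q z) z"
    and p: "\<And>z. z \<in> ball 0 1 \<Longrightarrow> wirt p (pp z) (pq z) z"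
    and q: "\<And>z. z \<in> ball 0 1 \<Longrightarrow> wirt q (qp z) (qq z) z"
    and c: "continuous_on (ball 0 1) pp" "continuous_on (ball 0 1) pq"
       "continuous_on (ball 0 1) qp" "continuous_on (ball 0 1) qq"
    and z: "z \<in> ball 0 1"
  shows "pq z = qp z"
proof -
  obtain d where d: "0 < d" "\<And>x y. \<bar>x - Re z\<bar> < d \<Longrightarrow> \<bar>y - Im z\<bar> < d \<Longrightarrow> Complex x y \<in> ball 0 1"
    using small_box_in_ball[OF z] by blast
  define x0 y0 where "x0 = Re z" and "y0 = Im z"
  define x1 where "x1 = x0 + d / 2"
  let ?U = "{y0 - d<..<y0 + d}"
  have box: "Complex x y \<in> ball 0 1" if "x \<in> {x0..x1}" "y \<in> ?U" for x y
    using that d(1) by (intro d(2)) (auto simp: x0_def y0_def x1_def abs_less_iff)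
  have line: "((\<lambda>x. Complex x y) has_vector_derivative 1) (at x within S)"
     "((\<lambda>y. Complex x y) has_vector_derivative \<i>) (at y within S')" for x y S S'
    unfolding has_vector_derivative_complex_iff by (auto intro!: derivative_eq_intros)
  define g where "g = (\<lambda>z. (pp z + qp z) * \<i> + (pq z + qq z) * cnj \<i>)"
  have y0: "y0 \<in> ?U" and x0: "x0 \<in> {x0..x1}" using d(1) by (auto simp: x1_def)
  have xd: "((\<lambda>x. F (Complex x y)) has_vector_derivative A * 1 + B * cnj 1) (at x within S)"
    if "wirt F A B (Complex x y)" for F A B x y S
    by (rule wirt_curve[OF that line(1)])
  have yd: "((\<lambda>y. F (Complex x y)) has_vector_derivative A * \<i> + B * cnj \<i>) (at y within S)"
    if "wirt F A B (Complex x y)" for F A B x y S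
    by (rule wirt_curve[OF that line(2)])
  define fy where "fy = (\<lambda>z. p z * \<i> + q z * cnj \<i>)"
  have key: "fy (Complex x y0) = fy (Complex x0 y0) + integral {x0..x} (\<lambda>t. g (Complex t y0))"
    if x: "x \<in> {x0..x1}" for x
  proof -
    have int: "((\<lambda>t. p (Complex t y) + q (Complex t y)) has_integral f (Complex x y) - f (Complex x0 y)) {x0..x}"
      if y: "y \<in> ?U" for y
    proof (rule fundamental_theorem_of_calculus)
      show "((\<lambda>x. f (Complex x y)) has_vector_derivative p (Complex t y) + q (Complex t y)) (at t within {x0..x})"
        if "t \<in> {x0..x}" for t
        using xd[OF f[OF box[of t y]], of "{x0..x}"] that x y by auto
    qed (use x in auto)
    have "((\<lambda>y. integral (cbox x0 x) (\<lambda>t. p (Complex t y) + q (Complex t y))) has_vector_derivative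
        integral (cbox x0 x) (\<lambda>t. g (Complex t y0))) (at y0 within ?U)"
    proof (rule leibniz_rule_vector_derivative)
      show "((\<lambda>y. p (Complex t y) + q (Complex t y)) has_vector_derivative g (Complex t y)) (at y within ?U)"
        if "y \<in> ?U" "t \<in> cbox x0 x" for y t
        using yd[OF wirt_add[OF p q], of t y ?U] box[of t y] that x unfolding g_def by auto
      show "(\<lambda>t. p (Complex t y) + q (Complex t y)) integrable_on cbox x0 x" if "y \<in> ?U" for y
        using int[OF that] by auto
      show "continuous_on (?U \<times> cbox x0 x) (\<lambda>(y, t). g (Complex t y))"
        unfolding case_prod_beta g_def
        by (intro continuous_intros continuous_on_Complex continuous_on_compose2[OF c(1)] continuous_on_compose2[OF c(2)]
              continuous_on_compose2[OF c(3)] continuous_on_compose2[OF c(4)])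
           (use box x in auto)
    qed (use y0 in auto)
    then have "((\<lambda>y. f (Complex x y) - f (Complex x0 y)) has_vector_derivative
        integral {x0..x} (\<lambda>t. g (Complex t y0))) (at y0 within ?U)"
      unfolding cbox_interval
      by (rule has_vector_derivative_transform[OF y0, rotated]) (simp add: integral_unique[OF int])
    moreover have "((\<lambda>y. f (Complex x y) - f (Complex x0 y)) has_vector_derivative
        fy (Complex x y0) - fy (Complex x0 y0)) (at y0 within ?U)"
      unfolding fy_def
      by (intro has_vector_derivative_diff yd f box x0 x y0)
    moreover have "at y0 within ?U \<noteq> bot"
      using y0 at_within_open[OF y0] by (metis open_greaterThanLessThan trivial_limit_at)
    ultimately have "integral {x0..x} (\<lambda>t. g (Complex t y0)) = fy (Complex x y0) - fy (Complex x0 y0)"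
      by (intro vector_derivative_unique_within[of y0 ?U])
    then show ?thesis by simp
  qed
  have "continuous_on {x0..x1} (\<lambda>t. g (Complex t y0))"
    unfolding g_def
    by (intro continuous_intros continuous_on_Complex continuous_on_compose2[OF c(1)] continuous_on_compose2[OF c(2)]
              continuous_on_compose2[OF c(3)] continuous_on_compose2[OF c(4)])
       (use box y0 in auto)
  then have "((\<lambda>u. integral {x0..u} (\<lambda>t. g (Complex t y0))) has_vector_derivative g (Complex x0 y0)) (at x0 within {x0..x1})"
    using x0 by (rule integral_has_vector_derivative)
  then have "((\<lambda>u. fy (Complex x0 y0) + integral {x0..u} (\<lambda>t. g (Complex t y0))) has_vector_derivative g (Complex x0 y0)) (at x0 within {x0..x1})"
    by (auto intro!: derivative_eq_intros)
  then have "((\<lambda>x. fy (Complex x y0)) has_vector_derivative g (Complex x0 y0)) (at x0 within {x0..x1})"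
    by (rule has_vector_derivative_transform[OF x0, rotated]) (rule key)
  moreover have "((\<lambda>x. fy (Complex x y0)) has_vector_derivative
      (\<i> * pp (Complex x0 y0) + cnj \<i> * qp (Complex x0 y0)) * 1
      + (\<i> * pq (Complex x0 y0) + cnj \<i> * qq (Complex x0 y0)) * cnj 1) (at x0 within {x0..x1})"
  proof (rule xd)
    have fy_eq: "fy = (\<lambda>z. \<i> * p z + cnj \<i> * q z)" by (auto simp: fy_def)
    show "wirt fy (\<i> * pp (Complex x0 y0) + cnj \<i> * qp (Complex x0 y0))
       (\<i> * pq (Complex x0 y0) + cnj \<i> * qq (Complex x0 y0)) (Complex x0 y0)"
      unfolding fy_eq by (intro wirt_add wirt_cmult p q box x0 y0)
  qed
  ultimately have "g (Complex x0 y0) = (\<i> * pp (Complex x0 y0) + cnj \<i> * qp (Complex x0 y0)) * 1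
      + (\<i> * pq (Complex x0 y0) + cnj \<i> * qq (Complex x0 y0)) * cnj 1"
    using d(1) by (intro vector_derivative_unique_within_closed_interval[of x0 x1 x0]) (auto simp: x1_def)
  moreover have "Complex x0 y0 = z" by (simp add: x0_def y0_def)
  ultimately show ?thesis by (simp add: g_def algebra_simps)
qed

section \<open>Solutions on the polydisc and their slices\<close>

lemma polydisc_upd: "z \<in> polydisc l \<Longrightarrow> j \<in> {1..l} \<Longrightarrow> \<zeta> \<in> ball 0 1 \<Longrightarrow> z(j := \<zeta>) \<in> polydisc l"
  unfolding polydisc_def by (auto simp: PiE_iff extensional_def)

lemma polydisc_coord: "z \<in> polydisc l \<Longrightarrow> j \<in> {1..l} \<Longrightarrow> norm (z j) < 1"
  unfolding polydisc_def by (auto simp: PiE_iff)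

lemma continuous_on_fun_upd: "continuous_on S (\<lambda>\<zeta>. (z :: nat \<Rightarrow> complex)(j := \<zeta>))"
proof (rule continuous_on_coordinatewise_then_product)
  show "continuous_on S (\<lambda>\<zeta>. (z(j := \<zeta>)) i)" for i by (cases "i = j") auto
qed

lemma continuous_on_slice:
  assumes "continuous_on (polydisc l) u" "z \<in> polydisc l" "j \<in> {1..l}"
  shows "continuous_on (ball 0 1) (\<lambda>\<zeta>. u (z(j := \<zeta>)))"
  by (rule continuous_on_compose2[OF assms(1) continuous_on_fun_upd])
     (use polydisc_upd[OF assms(2,3)] in auto)

lemma partial_eq_dz_dzbar:
  assumes "v \<in> {1, \<i>}"
  shows "partial v j u z = v * dz j u z + cnj v * dzbar j u z"
  using assms by (auto simp: dz_def dzbar_def field_simps)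

lemma slice_wirt:
  assumes "wirt (\<lambda>\<zeta>. F (z(j := \<zeta>))) p q (z j)"
  shows "(slice v j F z has_vector_derivative (p * v + q * cnj v)) (at 0)"
proof -
  have "((\<lambda>t. z j + of_real t * v) has_vector_derivative v) (at 0)"
    unfolding has_vector_derivative_def by (auto intro!: derivative_eq_intros simp: scaleR_conv_of_real)
  from wirt_curve[OF _ this] assms show ?thesis unfolding slice_def by auto
qed

lemma dz_wirt:
  assumes "wirt (\<lambda>\<zeta>. F (z(j := \<zeta>))) p q (z j)"
  shows "dz j F z = p" "dzbar j F z = q"
proof -
  have "partial v j F z = p * v + q * cnj v" for v
    unfolding partial_def by (rule vector_derivative_at[OF slice_wirt[OF assms]])
  then show "dz j F z = p" "dzbar j F z = q"
    by (simp_all add: dz_def dzbar_def field_simps)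
qed

lemma C_polydisc_continuous: "C_polydisc m l u \<Longrightarrow> continuous_on (polydisc l) u"
  by (cases m) auto

lemma C_polydisc_SucD:
  assumes "C_polydisc (Suc m) l u" "j \<in> {1..l}" "v \<in> {1, \<i>}"
  shows "C_polydisc m l (partial v j u)"
    and "z \<in> polydisc l \<Longrightarrow>
      (slice v j u z has_vector_derivative partial v j u z) (at 0)"
  using assms unfolding partial_def vector_derivative_works[symmetric] C_polydisc.simps by blast+

lemma C_polydisc_slice_wirt:
  assumes C: "C_polydisc (Suc m) l u" and z: "z \<in> polydisc l" and j: "j \<in> {1..l}"
  shows "wirt (\<lambda>\<zeta>. u (z(j := \<zeta>))) (dz j u z) (dzbar j u z) (z j)"
proof -
  have d: "((\<lambda>t. u (z(j := \<zeta> + of_real t * v))) has_vector_derivative partial v j u (z(j := \<zeta>))) (at 0)"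
    if "\<zeta> \<in> ball 0 1" "v \<in> {1, \<i>}" for \<zeta> v
    using C_polydisc_SucD(2)[OF C j that(2) polydisc_upd[OF z j that(1)]] unfolding slice_def by simp
  have "continuous_on (polydisc l) (partial \<i> j u)"
    by (rule C_polydisc_continuous[OF C_polydisc_SucD(1)[OF C j]]) simp
  then have c: "continuous_on (ball 0 1) (\<lambda>\<zeta>. partial \<i> j u (z(j := \<zeta>)))"
    by (rule continuous_on_slice[OF _ z j])
  have zj: "z j \<in> ball 0 1" using polydisc_coord[OF z j] by simp
  have d1: "((\<lambda>t. u (z(j := \<zeta> + of_real t))) has_vector_derivative partial 1 j u (z(j := \<zeta>))) (at 0)"
    if "\<zeta> \<in> ball 0 1" for \<zeta>
    using d[OF that, of 1] by simp
  have "wirt (\<lambda>\<zeta>. u (z(j := \<zeta>)))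
      ((partial 1 j u (z(j := z j)) - \<i> * partial \<i> j u (z(j := z j))) / 2)
      ((partial 1 j u (z(j := z j)) + \<i> * partial \<i> j u (z(j := z j))) / 2) (z j)"
    by (rule wirt_of_partials[where f="\<lambda>\<zeta>. u (z(j := \<zeta>))" and fx="\<lambda>\<zeta>. partial 1 j u (z(j := \<zeta>))"
          and fy="\<lambda>\<zeta>. partial \<i> j u (z(j := \<zeta>))", OF d1 d c zj]) auto
  then show ?thesis by (simp add: dz_def dzbar_def)
qed

lemma C_polydisc_second_derivatives:
  assumes C: "C_polydisc 2 l u" and j: "j \<in> {1..l}"
  shows "\<And>z. z \<in> polydisc l \<Longrightarrow> wirt (\<lambda>\<zeta>. dz j u (z(j := \<zeta>))) (dz j (dz j u) z) (dzbar j (dz j u) z) (z j)"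
    and "\<And>z. z \<in> polydisc l \<Longrightarrow> wirt (\<lambda>\<zeta>. dzbar j u (z(j := \<zeta>))) (dz j (dzbar j u) z) (dzbar j (dzbar j u) z) (z j)"
    and "continuous_on (polydisc l) (dz j (dz j u))" "continuous_on (polydisc l) (dzbar j (dz j u))"
     "continuous_on (polydisc l) (dz j (dzbar j u))" "continuous_on (polydisc l) (dzbar j (dzbar j u))"
    and "\<And>z. z \<in> polydisc l \<Longrightarrow> dz j (dzbar j u) z =
       (partial 1 j (partial 1 j u) z - \<i> * partial \<i> j (partial 1 j u) z
        + \<i> * (partial 1 j (partial \<i> j u) z - \<i> * partial \<i> j (partial \<i> j u) z)) / 4"
proof -
  have C1: "C_polydisc (Suc 0) l (partial v j u)" if "v \<in> {1, \<i>}" for v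
    by (rule C_polydisc_SucD(1)[OF C[unfolded numeral_2_eq_2] j that])
  have w: "wirt (\<lambda>\<zeta>. partial v j u (z(j := \<zeta>))) (dz j (partial v j u) z) (dzbar j (partial v j u) z) (z j)"
    if "v \<in> {1, \<i>}" "z \<in> polydisc l" for v z
    by (rule C_polydisc_slice_wirt[OF C1[OF that(1)] that(2) j])
  have cont: "continuous_on (polydisc l) (partial v' j (partial v j u))" if "v \<in> {1, \<i>}" "v' \<in> {1, \<i>}" for v v'
    by (rule C_polydisc_continuous[OF C_polydisc_SucD(1)[OF C1[OF that(1)] j that(2)]])
  have cd: "continuous_on (polydisc l) (dz j (partial v j u))" "continuous_on (polydisc l) (dzbar j (partial v j u))"
    if "v \<in> {1, \<i>}" for v
    unfolding dz_def[abs_def] dzbar_def[abs_def] by (intro continuous_intros cont that; simp)+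
  have e: "(\<lambda>x. (1/2) * (partial 1 j u x) - (1/2) * (\<i> * partial \<i> j u x)) = dz j u"
     "(\<lambda>x. (1/2) * (partial 1 j u x) + (1/2) * (\<i> * partial \<i> j u x)) = dzbar j u"
    by (auto simp: dz_def dzbar_def field_simps)
  have 1: "wirt (\<lambda>\<zeta>. dz j u (z(j := \<zeta>)))
      ((1/2) * dz j (partial 1 j u) z - (1/2) * (\<i> * dz j (partial \<i> j u) z))
      ((1/2) * dzbar j (partial 1 j u) z - (1/2) * (\<i> * dzbar j (partial \<i> j u) z)) (z j)"
    if z: "z \<in> polydisc l" for z
    unfolding e(1)[symmetric] by (intro wirt_diff wirt_cmult w z) auto
  have 2: "wirt (\<lambda>\<zeta>. dzbar j u (z(j := \<zeta>)))
      ((1/2) * dz j (partial 1 j u) z + (1/2) * (\<i> * dz j (partial \<i> j u) z))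
      ((1/2) * dzbar j (partial 1 j u) z + (1/2) * (\<i> * dzbar j (partial \<i> j u) z)) (z j)"
    if z: "z \<in> polydisc l" for z
    unfolding e(2)[symmetric] by (intro wirt_add wirt_cmult w z) auto
  show "wirt (\<lambda>\<zeta>. dz j u (z(j := \<zeta>))) (dz j (dz j u) z) (dzbar j (dz j u) z) (z j)"
    "wirt (\<lambda>\<zeta>. dzbar j u (z(j := \<zeta>))) (dz j (dzbar j u) z) (dzbar j (dzbar j u) z) (z j)"
    if z: "z \<in> polydisc l" for z
    using 1[OF z] 2[OF z] dz_wirt[OF 1[OF z]] dz_wirt[OF 2[OF z]] by simp_all
  show "continuous_on (polydisc l) (dz j (dz j u))"
    by (subst continuous_on_cong[OF refl dz_wirt(1)[OF 1]]) (auto intro!: continuous_intros cd)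
  show "continuous_on (polydisc l) (dzbar j (dz j u))"
    by (subst continuous_on_cong[OF refl dz_wirt(2)[OF 1]]) (auto intro!: continuous_intros cd)
  show "continuous_on (polydisc l) (dz j (dzbar j u))"
    by (subst continuous_on_cong[OF refl dz_wirt(1)[OF 2]]) (auto intro!: continuous_intros cd)
  show "continuous_on (polydisc l) (dzbar j (dzbar j u))"
    by (subst continuous_on_cong[OF refl dz_wirt(2)[OF 2]]) (auto intro!: continuous_intros cd)
  show "dz j (dzbar j u) z =
       (partial 1 j (partial 1 j u) z - \<i> * partial \<i> j (partial 1 j u) z
        + \<i> * (partial 1 j (partial \<i> j u) z - \<i> * partial \<i> j (partial \<i> j u) z)) / 4"
    if z: "z \<in> polydisc l" for z
    unfolding dz_wirt(1)[OF 2[OF z]] by (simp add: dz_def[of j "partial _ j u"] field_simps)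
qed

lemma slice_solves_L:
  assumes u: "u \<in> sh l a b" and z: "z \<in> polydisc l" and j: "j \<in> {1..l}"
  shows "solves_L (a j) (b j) (\<lambda>\<zeta>. u (z(j := \<zeta>))) (\<lambda>\<zeta>. dz j u (z(j := \<zeta>))) (\<lambda>\<zeta>. dzbar j u (z(j := \<zeta>)))
    (\<lambda>\<zeta>. dz j (dz j u) (z(j := \<zeta>))) (\<lambda>\<zeta>. dz j (dzbar j u) (z(j := \<zeta>))) (\<lambda>\<zeta>. dzbar j (dzbar j u) (z(j := \<zeta>)))"
proof -
  have C: "C_polydisc 2 l u" and L: "\<And>z. z \<in> polydisc l \<Longrightarrow> L_op (a j) (b j) j u z = 0"
    using u j unfolding sh_def by auto
  have zu: "z(j := \<zeta>) \<in> polydisc l" if "\<zeta> \<in> ball 0 1" for \<zeta>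
    by (rule polydisc_upd[OF z j that])
  note d2 = C_polydisc_second_derivatives[OF C j]
  have w1: "wirt (\<lambda>\<zeta>. u (z(j := \<zeta>))) (dz j u (z(j := \<zeta>))) (dzbar j u (z(j := \<zeta>))) \<zeta>" if "\<zeta> \<in> ball 0 1" for \<zeta>
    using C_polydisc_slice_wirt[OF C[unfolded numeral_2_eq_2] zu[OF that] j] by simp
  have w2: "wirt (\<lambda>\<zeta>. dz j u (z(j := \<zeta>))) (dz j (dz j u) (z(j := \<zeta>))) (dzbar j (dz j u) (z(j := \<zeta>))) \<zeta>"
    and w3: "wirt (\<lambda>\<zeta>. dzbar j u (z(j := \<zeta>))) (dz j (dzbar j u) (z(j := \<zeta>))) (dzbar j (dzbar j u) (z(j := \<zeta>))) \<zeta>"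
    if "\<zeta> \<in> ball 0 1" for \<zeta>
    using d2(1,2)[OF zu[OF that]] by simp_all
  note c = d2(3-6)[THEN continuous_on_slice, OF z j]
  have comm: "dzbar j (dz j u) (z(j := \<zeta>)) = dz j (dzbar j u) (z(j := \<zeta>))" if "\<zeta> \<in> ball 0 1" for \<zeta>
    by (rule mixed_wirt_derivatives_commute[OF w1 w2 w3 c that])
  show ?thesis
    unfolding solves_L_def
  proof (intro conjI ballI c w1 w3)
    fix \<zeta> :: complex assume \<zeta>: "\<zeta> \<in> ball 0 1"
    show "wirt (\<lambda>\<zeta>. dz j u (z(j := \<zeta>))) (dz j (dz j u) (z(j := \<zeta>))) (dz j (dzbar j u) (z(j := \<zeta>))) \<zeta>"
      using w2[OF \<zeta>] comm[OF \<zeta>] by simp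
    show "(1 - of_real ((cmod \<zeta>)\<^sup>2)) * dz j (dzbar j u) (z(j := \<zeta>)) + a j * \<zeta> * dz j u (z(j := \<zeta>))
        + b j * cnj \<zeta> * dzbar j u (z(j := \<zeta>)) - a j * b j * u (z(j := \<zeta>)) = 0"
      using L[OF zu[OF \<zeta>]] by (simp add: L_op_def)
  qed
qed

lemma partial_partial_same:
  assumes u: "u \<in> sh l a b" and z: "z \<in> polydisc l" and j: "j \<in> {1..l}" and v: "v \<in> {1, \<i>}" "v' \<in> {1, \<i>}"
  shows "partial v' j (partial v j u) z = v' * v * dz j (dz j u) z
     + (v' * cnj v + cnj v' * v) * dz j (dzbar j u) z + cnj v' * cnj v * dzbar j (dzbar j u) z"
proof -
  have s: "solves_L (a j) (b j) (\<lambda>\<zeta>. u (z(j := \<zeta>))) (\<lambda>\<zeta>. dz j u (z(j := \<zeta>))) (\<lambda>\<zeta>. dzbar j u (z(j := \<zeta>)))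
    (\<lambda>\<zeta>. dz j (dz j u) (z(j := \<zeta>))) (\<lambda>\<zeta>. dz j (dzbar j u) (z(j := \<zeta>))) (\<lambda>\<zeta>. dzbar j (dzbar j u) (z(j := \<zeta>)))"
    by (rule slice_solves_L[OF u z j])
  have zj: "z j \<in> ball 0 1" using polydisc_coord[OF z j] by simp
  have w: "wirt (\<lambda>\<zeta>. dz j u (z(j := \<zeta>))) (dz j (dz j u) z) (dz j (dzbar j u) z) (z j)"
     "wirt (\<lambda>\<zeta>. dzbar j u (z(j := \<zeta>))) (dz j (dzbar j u) z) (dzbar j (dzbar j u) z) (z j)"
    using s[unfolded solves_L_def, THEN conjunct1, THEN bspec, OF zj] by simp_all
  have "wirt (\<lambda>\<zeta>. partial v j u (z(j := \<zeta>))) (v * dz j (dz j u) z + cnj v * dz j (dzbar j u) z)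
       (v * dz j (dzbar j u) z + cnj v * dzbar j (dzbar j u) z) (z j)"
    unfolding partial_eq_dz_dzbar[OF v(1)] by (intro wirt_add wirt_cmult w)
  from dz_wirt[OF this] show ?thesis
    unfolding partial_eq_dz_dzbar[OF v(2)] by (simp add: algebra_simps)
qed

section \<open>Interior estimates on the polydisc\<close>

lemma derivative_bound_mono:
  assumes "derivative_bound a b R C" "C \<le> D"
  shows "derivative_bound a b R D"
  unfolding derivative_bound_def
proof (intro conjI allI impI)
  show "0 \<le> D" using assms by (auto simp: derivative_bound_def)
  fix f p q pp pq qq :: "complex \<Rightarrow> complex" and B :: real and c :: complex
  assume s: "solves_L a b f p q pp pq qq" and B: "\<forall>z\<in>ball 0 1. norm (f z) \<le> B" and c: "norm c \<le> R"
  have "0 \<le> B" using B[rule_format, of 0] norm_ge_zero[of "f 0"] by (auto simp del: norm_ge_zero)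
  then have "C * B \<le> D * B" using assms(2) by (rule mult_right_mono[rotated])
  then show "norm (p c) \<le> D * B" "norm (q c) \<le> D * B"
     "norm (pp c) \<le> D * B" "norm (pq c) \<le> D * B" "norm (qq c) \<le> D * B"
    using derivative_boundD[OF assms(1) s B[rule_format] c] by linarith+
qed

lemma uniform_derivative_bound:
  fixes l :: nat
  assumes R: "R < 1"
  obtains C where "\<And>j. j \<in> {1..l} \<Longrightarrow> derivative_bound (a j) (b j) R C" "0 \<le> C"
proof -
  obtain C where C: "\<And>j. derivative_bound (a j) (b j) R (C j)"
    using choice[of "\<lambda>j. derivative_bound (a j) (b j) R"] interior_bound[OF R] by blast
  have nonneg: "0 \<le> C j" for j using C[of j] by (simp add: derivative_bound_def)
  show thesis
  proof (rule that)
    show "derivative_bound (a j) (b j) R (\<Sum>j\<in>{1..l}. C j)" if "j \<in> {1..l}" for j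
      by (rule derivative_bound_mono[OF C]) (use that nonneg in \<open>auto intro: member_le_sum\<close>)
    show "0 \<le> (\<Sum>j\<in>{1..l}. C j)" by (intro sum_nonneg nonneg)
  qed
qed

lemma norm_direction: "v \<in> {1, \<i>} \<Longrightarrow> norm v = 1"
  by auto

text \<open>The estimates are stated for differences of two solutions: this is the form in which they show that
  derivatives of a convergent sequence form Cauchy sequences.\<close>

lemma partial_bound:
  assumes R: "R < 1"
  shows "\<exists>C\<ge>0. \<forall>u\<in>sh l a b. \<forall>u'\<in>sh l a b. \<forall>B. (\<forall>z\<in>polydisc l. norm (u z - u' z) \<le> B) \<longrightarrow>
     (\<forall>j\<in>{1..l}. \<forall>v\<in>{1, \<i>}. \<forall>z\<in>polydisc l. norm (z j) \<le> R \<longrightarrow>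
        norm (partial v j u z - partial v j u' z) \<le> C * B \<and>
        (\<forall>v'\<in>{1, \<i>}. norm (partial v' j (partial v j u) z - partial v' j (partial v j u') z) \<le> C * B))"
proof -
  obtain C where C: "\<And>j. j \<in> {1..l} \<Longrightarrow> derivative_bound (a j) (b j) R C" and C0: "0 \<le> C"
    using uniform_derivative_bound[OF R, of l a b] by blast
  show ?thesis
  proof (intro exI[of _ "4 * C"] conjI ballI allI impI)
    show "0 \<le> 4 * C" using C0 by simp
    fix u u' B j v z
    assume u: "u \<in> sh l a b" and u': "u' \<in> sh l a b" and B: "\<forall>z\<in>polydisc l. norm (u z - u' z) \<le> B"
      and j: "j \<in> {1..l}" and v: "v \<in> {1, \<i>}" and z: "z \<in> polydisc l" and zR: "norm (z j) \<le> R"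
    have "norm (1 * u (z(j := \<zeta>)) + (-1) * u' (z(j := \<zeta>))) \<le> B" if "\<zeta> \<in> ball 0 1" for \<zeta>
      using B polydisc_upd[OF z j that] by simp
    note * = derivative_boundD[OF C[OF j] solves_L_lincomb[OF slice_solves_L[OF u z j] slice_solves_L[OF u' z j]] this zR]
    have b: "norm (dz j u z - dz j u' z) \<le> C * B" "norm (dzbar j u z - dzbar j u' z) \<le> C * B"
      "norm (dz j (dz j u) z - dz j (dz j u') z) \<le> C * B"
      "norm (dz j (dzbar j u) z - dz j (dzbar j u') z) \<le> C * B"
      "norm (dzbar j (dzbar j u) z - dzbar j (dzbar j u') z) \<le> C * B"
      using *(1) *(2) *(3) *(4) *(5) by simp_all
    have CB: "0 \<le> C * B" using b(1) by (rule order_trans[OF norm_ge_zero])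
    have "partial v j u z - partial v j u' z = v * (dz j u z - dz j u' z) + cnj v * (dzbar j u z - dzbar j u' z)"
      unfolding partial_eq_dz_dzbar[OF v] by (simp add: algebra_simps)
    also have "norm \<dots> \<le> C * B + C * B"
      by (intro order_trans[OF norm_triangle_ineq] add_mono) (simp_all add: norm_mult norm_direction[OF v] b)
    also have "\<dots> \<le> 4 * C * B" using CB unfolding mult.assoc by linarith
    finally show "norm (partial v j u z - partial v j u' z) \<le> 4 * C * B" .
    fix v' :: complex assume v': "v' \<in> {1, \<i>}"
    have "partial v' j (partial v j u) z - partial v' j (partial v j u') z
       = v' * v * (dz j (dz j u) z - dz j (dz j u') z)
       + (v' * cnj v * (dz j (dzbar j u) z - dz j (dzbar j u') z)
       + cnj v' * v * (dz j (dzbar j u) z - dz j (dzbar j u') z))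
       + cnj v' * cnj v * (dzbar j (dzbar j u) z - dzbar j (dzbar j u') z)"
      unfolding partial_partial_same[OF u z j v v'] partial_partial_same[OF u' z j v v']
      by (simp add: algebra_simps)
    also have "norm \<dots> \<le> C * B + (C * B + C * B) + C * B"
      by (intro order_trans[OF norm_triangle_ineq] add_mono)
         (simp_all add: norm_mult norm_direction[OF v] norm_direction[OF v'] b)
    also have "\<dots> = 4 * C * B" by simp
    finally show "norm (partial v' j (partial v j u) z - partial v' j (partial v j u') z) \<le> 4 * C * B" .
  qed
qed

lemma norm_vector_derivative_le:
  fixes f :: "real \<Rightarrow> 'a::real_normed_vector"
  assumes f: "(f has_vector_derivative D) (at 0)" and d: "0 < d"
    and K: "\<And>h. \<bar>h\<bar> \<le> d \<Longrightarrow> norm (f h - f 0) \<le> K * \<bar>h\<bar>"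
  shows "norm D \<le> K"
proof (rule field_le_epsilon)
  fix e :: real assume e: "0 < e"
  obtain d' where d': "0 < d'" "\<And>y. norm (y - 0) < d' \<Longrightarrow> norm (f y - f 0 - (y - 0) *\<^sub>R D) \<le> e * norm (y - 0)"
    using f e unfolding has_vector_derivative_def has_derivative_at_alt by blast
  define h where "h = min d (d' / 2)"
  have h: "0 < h" "h \<le> d" "h < d'" using d d'(1) by (auto simp: h_def)
  have "norm (h *\<^sub>R D) \<le> norm (f h - f 0) + norm (f h - f 0 - (h - 0) *\<^sub>R D)"
    using norm_triangle_ineq4[of "f h - f 0" "f h - f 0 - h *\<^sub>R D"] by simp
  also have "\<dots> \<le> K * h + e * h"
    using K[of h] d'(2)[of h] h by (intro add_mono) auto
  finally have "h * norm D \<le> h * (K + e)" using h by (simp add: algebra_simps)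
  then show "norm D \<le> K + e" using h by simp
qed

lemma norm_increment_le:
  fixes f :: "real \<Rightarrow> 'a::real_normed_vector"
  assumes f: "\<And>t. \<bar>t\<bar> \<le> \<bar>h\<bar> \<Longrightarrow> (f has_vector_derivative f' t) (at t)"
    and K: "\<And>t. \<bar>t\<bar> \<le> \<bar>h\<bar> \<Longrightarrow> norm (f' t) \<le> K"
  shows "norm (f h - f 0) \<le> K * \<bar>h\<bar>"
proof -
  have "norm (f h - f 0) \<le> K * norm (h - 0)"
  proof (rule differentiable_bound[of "{-\<bar>h\<bar>..\<bar>h\<bar>}" f "\<lambda>t x. x *\<^sub>R f' t"])
    show "(f has_derivative (\<lambda>x. x *\<^sub>R f' t)) (at t within {-\<bar>h\<bar>..\<bar>h\<bar>})" if "t \<in> {-\<bar>h\<bar>..\<bar>h\<bar>}" for t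
      using f[of t] that unfolding has_vector_derivative_def by (auto intro: has_derivative_at_withinI)
    show "onorm (\<lambda>x. x *\<^sub>R f' t) \<le> K" if "t \<in> {-\<bar>h\<bar>..\<bar>h\<bar>}" for t
    proof (rule onorm_bound)
      have "norm (f' t) \<le> K" using K[of t] that by auto
      then show "0 \<le> K" "norm (x *\<^sub>R f' t) \<le> K * norm x" for x
        by (auto intro: order_trans[OF norm_ge_zero] simp: mult.commute[of K] mult_left_mono)
    qed
  qed auto
  then show ?thesis by simp
qed

lemma C_polydisc_line_derivative:
  assumes C: "C_polydisc (Suc m) l u" and z: "z \<in> polydisc l" and j: "j \<in> {1..l}" and v: "v \<in> {1, \<i>}"
    and t: "z j + of_real t * v \<in> ball 0 1"
  shows "((\<lambda>t. u (z(j := z j + of_real t * v))) has_vector_derivative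
     partial v j u (z(j := z j + of_real t * v))) (at t)"
proof -
  have w: "wirt (\<lambda>\<zeta>. u (z(j := \<zeta>))) (dz j u (z(j := z j + of_real t * v))) (dzbar j u (z(j := z j + of_real t * v)))
      (z j + of_real t * v)"
    using C_polydisc_slice_wirt[OF C polydisc_upd[OF z j t] j] by simp
  have "((\<lambda>t. z j + of_real t * v) has_vector_derivative v) (at t)"
    unfolding has_vector_derivative_def by (auto intro!: derivative_eq_intros simp: scaleR_conv_of_real)
  from wirt_curve[OF w this] show ?thesis
    unfolding partial_eq_dz_dzbar[OF v] by (simp add: mult.commute)
qed

text \<open>A difference quotient of \<open>u\<close> in the variable \<open>z\<^sub>j\<close> is, as a function of \<open>z\<^sub>i\<close>, again a solution of the
  equation in \<open>z\<^sub>i\<close>. Its supremum is controlled by the first order estimate in \<open>z\<^sub>j\<close>, so the first order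
  estimate in \<open>z\<^sub>i\<close> bounds its derivatives; let the step tend to zero.\<close>

lemma mixed_partial_bound:
  assumes R: "R < 1" and R0: "0 \<le> R"
  shows "\<exists>C\<ge>0. \<forall>u\<in>sh l a b. \<forall>u'\<in>sh l a b. \<forall>B. (\<forall>z\<in>polydisc l. norm (u z - u' z) \<le> B) \<longrightarrow>
     (\<forall>i\<in>{1..l}. \<forall>j\<in>{1..l}. \<forall>v\<in>{1, \<i>}. \<forall>v'\<in>{1, \<i>}. \<forall>z\<in>polydisc l.
        norm (z i) \<le> R \<longrightarrow> norm (z j) \<le> R \<longrightarrow> i \<noteq> j \<longrightarrow>
        norm (partial v' j (partial v i u) z - partial v' j (partial v i u') z) \<le> C * B)"
proof -
  \<comment> \<open>leaves room for steps of length \<open>R' - R\<close> in the variable \<open>z\<^sub>j\<close>\<close>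
  define R' where "R' = (1 + R) / 2"
  have R': "R' < 1" "R < R'" using R by (auto simp: R'_def)
  obtain C where C: "\<And>j. j \<in> {1..l} \<Longrightarrow> derivative_bound (a j) (b j) R C" and C0: "0 \<le> C"
    using uniform_derivative_bound[OF R, of l a b] by blast
  obtain C' where C'0: "0 \<le> C'" and C': "\<And>u u' B j v z. u \<in> sh l a b \<Longrightarrow> u' \<in> sh l a b \<Longrightarrow>
      \<forall>z\<in>polydisc l. norm (u z - u' z) \<le> B \<Longrightarrow> j \<in> {1..l} \<Longrightarrow> v \<in> {1, \<i>} \<Longrightarrow> z \<in> polydisc l \<Longrightarrow> norm (z j) \<le> R' \<Longrightarrow>
      norm (partial v j u z - partial v j u' z) \<le> C' * B"
    using partial_bound[OF R'(1), of l a b] by blast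
  show ?thesis
  proof (intro exI[of _ "2 * C * C'"] conjI ballI allI impI)
    show "0 \<le> 2 * C * C'" using C0 C'0 by simp
    fix u u' B i j v v' z
    assume u: "u \<in> sh l a b" and u': "u' \<in> sh l a b" and B: "\<forall>z\<in>polydisc l. norm (u z - u' z) \<le> B"
      and i: "i \<in> {1..l}" and j: "j \<in> {1..l}" and v: "v \<in> {1, \<i>}" and v': "v' \<in> {1, \<i>}"
      and z: "z \<in> polydisc l" and zi: "norm (z i) \<le> R" and zj: "norm (z j) \<le> R" and ij: "i \<noteq> j"
    have CC: "C_polydisc (Suc (Suc 0)) l u" "C_polydisc (Suc (Suc 0)) l u'"
      using u u' by (simp_all add: sh_def numeral_2_eq_2 del: C_polydisc.simps)
    let ?y = "\<lambda>t. z j + of_real t * v'"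
    have y_le: "norm (?y t) \<le> R'" if "\<bar>t\<bar> \<le> R' - R" for t
      using norm_triangle_ineq[of "z j" "of_real t * v'"] that zj by (simp add: norm_mult norm_direction[OF v'])
    have zt: "z(j := ?y t) \<in> polydisc l" if "\<bar>t\<bar> \<le> R' - R" for t
      using polydisc_upd[OF z j, of "?y t"] y_le[OF that] R' by simp
    let ?g = "\<lambda>t. partial v i u (z(j := ?y t)) - partial v i u' (z(j := ?y t))"
    have quot: "norm (?g h - ?g 0) \<le> 2 * C * C' * B * \<bar>h\<bar>" if h: "\<bar>h\<bar> \<le> R' - R" for h
    proof -
      \<comment> \<open>the increment in \<open>z\<^sub>j\<close> of \<open>u - u'\<close>, in the literal form produced by two applications of linearity\<close>
      let ?f = "\<lambda>\<zeta>. 1 * (1 * u (z(j := ?y h, i := \<zeta>)) + (-1) * u' (z(j := ?y h, i := \<zeta>)))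
         + (-1) * (1 * u (z(i := \<zeta>)) + (-1) * u' (z(i := \<zeta>)))"
      have f: "norm (?f \<zeta>) \<le> C' * B * \<bar>h\<bar>" if \<zeta>: "\<zeta> \<in> ball 0 1" for \<zeta>
      proof -
        have zi: "z(i := \<zeta>) \<in> polydisc l" by (rule polydisc_upd[OF z i \<zeta>])
        let ?p = "\<lambda>t. (z(i := \<zeta>))(j := (z(i := \<zeta>)) j + of_real t * v')"
        have p_eq: "?p t = z(j := ?y t, i := \<zeta>)" for t using ij by (simp add: fun_upd_twist)
        have "norm ((u (?p h) - u' (?p h)) - (u (?p 0) - u' (?p 0))) \<le> C' * B * \<bar>h\<bar>"
        proof (rule norm_increment_le)
          fix t assume t: "\<bar>t\<bar> \<le> \<bar>h\<bar>"
          have y: "norm (?y t) \<le> R'" using y_le[of t] t h by simp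
          then have yb: "(z(i := \<zeta>)) j + of_real t * v' \<in> ball 0 1" using R' ij by simp
          show "((\<lambda>t. u (?p t) - u' (?p t)) has_vector_derivative
              (partial v' j u (?p t) - partial v' j u' (?p t))) (at t)"
            by (intro has_vector_derivative_diff C_polydisc_line_derivative[OF CC(1) zi j v' yb]
                C_polydisc_line_derivative[OF CC(2) zi j v' yb])
          show "norm (partial v' j u (?p t) - partial v' j u' (?p t)) \<le> C' * B"
            by (rule C'[OF u u' B j v' polydisc_upd[OF zi j yb]]) (use y ij in simp)
        qed
        moreover have "?p 0 = z(i := \<zeta>)" using ij by (auto simp: fun_eq_iff)
        ultimately show ?thesis unfolding p_eq using ij by (simp add: algebra_simps fun_upd_twist)
      qed
      note s = solves_L_lincomb[OF solves_L_lincomb[OF slice_solves_L[OF u zt[OF h] i] slice_solves_L[OF u' zt[OF h] i]]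
          solves_L_lincomb[OF slice_solves_L[OF u z i] slice_solves_L[OF u' z i]]]
      have zh: "z(j := ?y h, i := z i) = z(j := ?y h)" using ij by (auto simp: fun_eq_iff)
      define P where "P = 1 * (1 * dz i u (z(j := ?y h, i := z i)) + (-1) * dz i u' (z(j := ?y h, i := z i)))
         + (-1) * (1 * dz i u (z(i := z i)) + (-1) * dz i u' (z(i := z i)))"
      define Q where "Q = 1 * (1 * dzbar i u (z(j := ?y h, i := z i)) + (-1) * dzbar i u' (z(j := ?y h, i := z i)))
         + (-1) * (1 * dzbar i u (z(i := z i)) + (-1) * dzbar i u' (z(i := z i)))"
      have PQ: "norm P \<le> C * (C' * B * \<bar>h\<bar>)" "norm Q \<le> C * (C' * B * \<bar>h\<bar>)"
        unfolding P_def Q_def by (rule derivative_boundD(1,2)[OF C[OF i] s f zi]; assumption)+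
      have "?g h - ?g 0 = v * P + cnj v * Q"
        unfolding partial_eq_dz_dzbar[OF v] P_def Q_def zh by (simp add: algebra_simps)
      also have "norm \<dots> \<le> C * (C' * B * \<bar>h\<bar>) + C * (C' * B * \<bar>h\<bar>)"
        by (intro order_trans[OF norm_triangle_ineq] add_mono) (simp_all add: norm_mult norm_direction[OF v] PQ)
      also have "\<dots> = 2 * C * C' * B * \<bar>h\<bar>" by simp
      finally show ?thesis .
    qed
    have "(?g has_vector_derivative (partial v' j (partial v i u) z - partial v' j (partial v i u') z)) (at 0)"
      using C_polydisc_SucD(2)[OF C_polydisc_SucD(1)[OF CC(1) i v] j v' z]
        C_polydisc_SucD(2)[OF C_polydisc_SucD(1)[OF CC(2) i v] j v' z]
      unfolding slice_def by (rule has_vector_derivative_diff)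
    then show "norm (partial v' j (partial v i u) z - partial v' j (partial v i u') z) \<le> 2 * C * C' * B"
      by (rule norm_vector_derivative_le[where d="R' - R"]) (use quot R' in auto)
  qed
qed

definition inner_polydisc :: "nat \<Rightarrow> real \<Rightarrow> (nat \<Rightarrow> complex) set"
  where "inner_polydisc l R = {z \<in> polydisc l. \<forall>j\<in>{1..l}. norm (z j) \<le> R}"

lemma second_order_bound:
  assumes R: "0 \<le> R" "R < 1"
  obtains C where "0 \<le> C"
    "\<And>u u' B i j v v' z. u \<in> sh l a b \<Longrightarrow> u' \<in> sh l a b \<Longrightarrow> (\<And>z. z \<in> polydisc l \<Longrightarrow> norm (u z - u' z) \<le> B) \<Longrightarrow>
       i \<in> {1..l} \<Longrightarrow> j \<in> {1..l} \<Longrightarrow> v \<in> {1, \<i>} \<Longrightarrow> v' \<in> {1, \<i>} \<Longrightarrow> z \<in> inner_polydisc l R \<Longrightarrow>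
        norm (partial v i u z - partial v i u' z) \<le> C * B \<and>
        norm (partial v' j (partial v i u) z - partial v' j (partial v i u') z) \<le> C * B"
proof -
  obtain C1 where C1: "0 \<le> C1" and C1': "\<forall>u\<in>sh l a b. \<forall>u'\<in>sh l a b. \<forall>B. (\<forall>z\<in>polydisc l. norm (u z - u' z) \<le> B) \<longrightarrow>
     (\<forall>j\<in>{1..l}. \<forall>v\<in>{1, \<i>}. \<forall>z\<in>polydisc l. norm (z j) \<le> R \<longrightarrow>
        norm (partial v j u z - partial v j u' z) \<le> C1 * B \<and>
        (\<forall>v'\<in>{1, \<i>}. norm (partial v' j (partial v j u) z - partial v' j (partial v j u') z) \<le> C1 * B))"
    using partial_bound[OF R(2), of l a b] by blast
  obtain C2 where C2: "0 \<le> C2" and C2': "\<forall>u\<in>sh l a b. \<forall>u'\<in>sh l a b. \<forall>B. (\<forall>z\<in>polydisc l. norm (u z - u' z) \<le> B) \<longrightarrow>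
     (\<forall>i\<in>{1..l}. \<forall>j\<in>{1..l}. \<forall>v\<in>{1, \<i>}. \<forall>v'\<in>{1, \<i>}. \<forall>z\<in>polydisc l.
        norm (z i) \<le> R \<longrightarrow> norm (z j) \<le> R \<longrightarrow> i \<noteq> j \<longrightarrow>
        norm (partial v' j (partial v i u) z - partial v' j (partial v i u') z) \<le> C2 * B)"
    using mixed_partial_bound[OF R(2,1), of l a b] by blast
  show thesis
  proof (rule that[of "C1 + C2"])
    show "0 \<le> C1 + C2" using C1 C2 by simp
    fix u u' B i j v v' z
    assume u: "u \<in> sh l a b" and u': "u' \<in> sh l a b" and B: "\<And>z. z \<in> polydisc l \<Longrightarrow> norm (u z - u' z) \<le> B"
      and i: "i \<in> {1..l}" and j: "j \<in> {1..l}" and v: "v \<in> {1, \<i>}" and v': "v' \<in> {1, \<i>}"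
      and z: "z \<in> inner_polydisc l R"
    have B': "\<forall>z\<in>polydisc l. norm (u z - u' z) \<le> B" using B by blast
    have zp: "z \<in> polydisc l" and zi: "norm (z i) \<le> R" and zj: "norm (z j) \<le> R"
      using z i j by (auto simp: inner_polydisc_def)
    have "0 \<le> B" using B[OF zp] norm_ge_zero[of "u z - u' z"] by linarith
    then have le: "C1 * B \<le> (C1 + C2) * B" "C2 * B \<le> (C1 + C2) * B"
      using C1 C2 by (auto intro: mult_right_mono)
    note one = C1'[rule_format, OF u u' B i v zp zi]
    have "norm (partial v' j (partial v i u) z - partial v' j (partial v i u') z) \<le> (C1 + C2) * B"
    proof (cases "i = j")
      case True
      then show ?thesis using one v' le(1) by force
    next
      case False
      then show ?thesis using C2'[rule_format, OF u u' B i j v v' zp zi zj] le(2) by linarith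
    qed
    moreover have "norm (partial v i u z - partial v i u' z) \<le> (C1 + C2) * B"
      using one le(1) by linarith
    ultimately show "norm (partial v i u z - partial v i u' z) \<le> (C1 + C2) * B \<and>
        norm (partial v' j (partial v i u) z - partial v' j (partial v i u') z) \<le> (C1 + C2) * B" by blast
  qed
qed

section \<open>Limits of solutions\<close>

text \<open>Locally uniform convergence, expressed on the exhaustion of the open polydisc by the sets
  \<open>inner_polydisc l R\<close>.\<close>

definition converges_inside :: "nat \<Rightarrow> (nat \<Rightarrow> (nat \<Rightarrow> complex) \<Rightarrow> complex) \<Rightarrow> ((nat \<Rightarrow> complex) \<Rightarrow> complex) \<Rightarrow> bool"
  where "converges_inside l F f \<longleftrightarrow>
    (\<forall>R. 0 \<le> R \<and> R < 1 \<longrightarrow> uniform_limit (inner_polydisc l R) F f sequentially)"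

lemma polydisc_exhaustion:
  assumes z: "z \<in> polydisc l"
  obtains R where "0 \<le> R" "R < 1" "\<And>j. j \<in> {1..l} \<Longrightarrow> norm (z j) < R"
proof -
  define m where "m = Max (insert 0 ((\<lambda>j. norm (z j)) ` {1..l}))"
  have m: "m < 1" "0 \<le> m" unfolding m_def using polydisc_coord[OF z] by auto
  have "norm (z j) < (1 + m) / 2" if "j \<in> {1..l}" for j
  proof -
    have "norm (z j) \<le> m" unfolding m_def using that by (intro Max_ge) auto
    then show ?thesis using m by simp
  qed
  then show thesis using m by (intro that[of "(1 + m) / 2"]) auto
qed

lemma open_coordinate_bound: "open {w :: nat \<Rightarrow> complex. \<forall>j\<in>{1..l::nat}. norm (w j) < R}"
proof -
  have "{w :: nat \<Rightarrow> complex. \<forall>j\<in>{1..l}. norm (w j) < R} = (\<Inter>j\<in>{1..l}. {w. norm (w j) < R})" by auto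
  moreover have "open {w :: nat \<Rightarrow> complex. norm (w j) < R}" for j
    by (intro open_Collect_less continuous_on_norm continuous_on_product_coordinates continuous_on_const)
  ultimately show ?thesis by auto
qed

lemma converges_inside_pointwise:
  assumes "converges_inside l F f" "z \<in> polydisc l"
  shows "(\<lambda>N. F N z) \<longlonglongrightarrow> f z"
proof -
  obtain R where R: "0 \<le> R" "R < 1" "\<And>j. j \<in> {1..l} \<Longrightarrow> norm (z j) < R"
    using polydisc_exhaustion[OF assms(2)] by blast
  have "z \<in> inner_polydisc l R" using assms(2) R(3) unfolding inner_polydisc_def by (blast intro: less_imp_le)
  moreover have "uniform_limit (inner_polydisc l R) F f sequentially"
    using assms(1) R by (simp add: converges_inside_def)
  ultimately show ?thesis by (rule tendsto_uniform_limitI[rotated])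
qed

lemma converges_inside_continuous:
  assumes F: "converges_inside l F f" and c: "\<And>N. continuous_on (polydisc l) (F N)"
  shows "continuous_on (polydisc l) f"
  unfolding continuous_on_eq_continuous_within
proof
  fix z assume z: "z \<in> polydisc l"
  obtain R where R: "0 \<le> R" "R < 1" "\<And>j. j \<in> {1..l} \<Longrightarrow> norm (z j) < R"
    using polydisc_exhaustion[OF z] by blast
  have "continuous_on (inner_polydisc l R) f"
  proof (rule uniform_limit_theorem)
    show "\<forall>\<^sub>F N in sequentially. continuous_on (inner_polydisc l R) (F N)"
      by (intro always_eventually allI continuous_on_subset[OF c]) (auto simp: inner_polydisc_def)
    show "uniform_limit (inner_polydisc l R) F f sequentially"
      using F R by (simp add: converges_inside_def)
  qed simp
  moreover have "z \<in> inner_polydisc l R" using z R(3) unfolding inner_polydisc_def by (blast intro: less_imp_le)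
  ultimately have "continuous (at z within inner_polydisc l R) f"
    by (simp add: continuous_on_eq_continuous_within)
  moreover have "at z within inner_polydisc l R = at z within polydisc l"
  proof (rule at_within_nhd[OF _ open_coordinate_bound])
    show "z \<in> {w. \<forall>j\<in>{1..l}. norm (w j) < R}" using R(3) by blast
    have "inner_polydisc l R \<inter> {w. \<forall>j\<in>{1..l}. norm (w j) < R} = polydisc l \<inter> {w. \<forall>j\<in>{1..l}. norm (w j) < R}"
      unfolding inner_polydisc_def by (blast intro: less_imp_le)
    then show "inner_polydisc l R \<inter> {w. \<forall>j\<in>{1..l}. norm (w j) < R} - {z}
       = polydisc l \<inter> {w. \<forall>j\<in>{1..l}. norm (w j) < R} - {z}" by simp
  qed
  ultimately show "continuous (at z within polydisc l) f" by simp
qed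

lemma slice_derivative_shift:
  assumes "(slice v j u (z(j := z j + of_real t * v)) has_vector_derivative D) (at 0)"
  shows "(slice v j u z has_vector_derivative D) (at t)"
proof -
  have "((\<lambda>x. slice v j u (z(j := z j + of_real t * v)) (x - t)) has_vector_derivative 1 *\<^sub>R D) (at t)"
    using assms
    by (intro vector_diff_chain_at[of "\<lambda>x. x - t" 1 t, unfolded o_def])
       (auto intro!: derivative_eq_intros simp del: fun_upd_apply)
  moreover have "slice v j u (z(j := z j + of_real t * v)) (x - t) = slice v j u z x" for x
    by (simp add: slice_def algebra_simps)
  ultimately show ?thesis by simp
qed

lemma slice_derivative_of_limit:
  assumes F: "converges_inside l F f"
    and d: "\<And>N z. z \<in> polydisc l \<Longrightarrow> (slice v j (F N) z has_vector_derivative partial v j (F N) z) (at 0)"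
    and G: "converges_inside l (\<lambda>N. partial v j (F N)) g"
    and j: "j \<in> {1..l}" and v: "v \<in> {1, \<i>}" and z: "z \<in> polydisc l"
  shows "(slice v j f z has_vector_derivative g z) (at 0)"
proof -
  obtain R where R: "0 \<le> R" "R < 1" "\<And>j. j \<in> {1..l} \<Longrightarrow> norm (z j) < R"
    using polydisc_exhaustion[OF z] by blast
  define \<delta> where "\<delta> = R - norm (z j)"
  define S where "S = {-\<delta><..<\<delta>}"
  have \<delta>: "0 < \<delta>" using R(3)[OF j] by (simp add: \<delta>_def)
  let ?p = "\<lambda>t. z(j := z j + of_real t * v)"
  have p: "?p t \<in> inner_polydisc l R" if "t \<in> S" for t
  proof -
    have "norm (z j + of_real t * v) \<le> R"
      using norm_triangle_ineq[of "z j" "of_real t * v"] that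
      by (auto simp: norm_mult norm_direction[OF v] S_def \<delta>_def)
    then show ?thesis
      using polydisc_upd[OF z j, of "z j + of_real t * v"] R(2) less_imp_le[OF R(3)]
      by (auto simp: inner_polydisc_def)
  qed
  have pp: "?p t \<in> polydisc l" if "t \<in> S" for t using p[OF that] by (simp add: inner_polydisc_def)
  have S0: "0 \<in> S" using \<delta> by (simp add: S_def)
  have lim: "(\<lambda>N. slice v j (F N) z t) \<longlonglongrightarrow> slice v j f z t" if "t \<in> S" for t
    using converges_inside_pointwise[OF F pp[OF that]] by (simp add: slice_def)
  have "\<exists>h. \<forall>t\<in>S. (\<lambda>N. slice v j (F N) z t) \<longlonglongrightarrow> h t \<and> (h has_derivative (\<lambda>x. x *\<^sub>R g (?p t))) (at t within S)"
  proof (rule has_derivative_sequence)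
    show "convex S" by (simp add: S_def)
    show "(slice v j (F N) z has_derivative (\<lambda>x. x *\<^sub>R partial v j (F N) (?p t))) (at t within S)" if "t \<in> S" for N t
      using slice_derivative_shift[OF d[OF pp[OF that]]] unfolding has_vector_derivative_def
      by (rule has_derivative_at_withinI)
    show "\<forall>\<^sub>F N in sequentially. \<forall>t\<in>S. \<forall>h. norm (h *\<^sub>R partial v j (F N) (?p t) - h *\<^sub>R g (?p t)) \<le> e * norm h"
      if "e > 0" for e
    proof -
      have "\<forall>\<^sub>F N in sequentially. \<forall>w\<in>inner_polydisc l R. dist (partial v j (F N) w) (g w) < e"
        using G R that unfolding converges_inside_def uniform_limit_iff by blast
      then show ?thesis
      proof (rule eventually_mono, intro ballI allI)
        fix N t and h :: real
        assume *: "\<forall>w\<in>inner_polydisc l R. dist (partial v j (F N) w) (g w) < e" and t: "t \<in> S"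
        have "norm (h *\<^sub>R partial v j (F N) (?p t) - h *\<^sub>R g (?p t)) = \<bar>h\<bar> * dist (partial v j (F N) (?p t)) (g (?p t))"
          by (simp add: dist_norm flip: scaleR_diff_right)
        also have "\<dots> \<le> \<bar>h\<bar> * e" using * p[OF t] by (intro mult_left_mono) (auto intro: less_imp_le)
        finally show "norm (h *\<^sub>R partial v j (F N) (?p t) - h *\<^sub>R g (?p t)) \<le> e * norm h"
          by (simp add: mult.commute)
      qed
    qed
    show "0 \<in> S" by (rule S0)
    show "(\<lambda>N. slice v j (F N) z 0) \<longlonglongrightarrow> slice v j f z 0" by (rule lim[OF S0])
  qed
  then obtain h where h: "\<And>t. t \<in> S \<Longrightarrow> (\<lambda>N. slice v j (F N) z t) \<longlonglongrightarrow> h t"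
     and dh: "(h has_derivative (\<lambda>x. x *\<^sub>R g (?p 0))) (at 0 within S)" using S0 by blast
  have eq: "h t = slice v j f z t" if "t \<in> S" for t
    using LIMSEQ_unique[OF h[OF that] lim[OF that]] .
  have "open S" by (simp add: S_def)
  have "(h has_derivative (\<lambda>x. x *\<^sub>R g (?p 0))) (at 0)"
    using dh at_within_open[OF S0 \<open>open S\<close>] by simp
  then have "(slice v j f z has_derivative (\<lambda>x. x *\<^sub>R g (?p 0))) (at 0)"
    by (rule has_derivative_transform_within_open[OF _ \<open>open S\<close> S0]) (rule eq)
  then show ?thesis by (simp add: has_vector_derivative_def)
qed

lemma partial_of_limit:
  assumes F: "converges_inside l F f"
    and d: "\<And>N z. z \<in> polydisc l \<Longrightarrow> (slice v j (F N) z has_vector_derivative partial v j (F N) z) (at 0)"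
    and G: "\<And>R. 0 \<le> R \<Longrightarrow> R < 1 \<Longrightarrow> uniformly_Cauchy_on (inner_polydisc l R) (\<lambda>N. partial v j (F N))"
    and j: "j \<in> {1..l}" and v: "v \<in> {1, \<i>}"
  shows "\<And>z. z \<in> polydisc l \<Longrightarrow> slice v j f z differentiable at 0"
    and "converges_inside l (\<lambda>N. partial v j (F N)) (partial v j f)"
proof -
  define g where "g = (\<lambda>z. lim (\<lambda>N. partial v j (F N) z))"
  have g: "converges_inside l (\<lambda>N. partial v j (F N)) g"
    unfolding converges_inside_def g_def
    using Cauchy_uniformly_convergent[OF G] by (simp add: uniformly_convergent_uniform_limit_iff)
  have der: "(slice v j f z has_vector_derivative g z) (at 0)" if "z \<in> polydisc l" for z
    by (rule slice_derivative_of_limit[OF F d g j v that])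
  then show "slice v j f z differentiable at 0" if "z \<in> polydisc l" for z
    using that by (blast intro: differentiableI_vector)
  have "partial v j f z = g z" if "z \<in> polydisc l" for z
    unfolding partial_def by (rule vector_derivative_at[OF der[OF that]])
  then have "uniform_limit (inner_polydisc l R) (\<lambda>N. partial v j (F N)) (partial v j f) sequentially
      \<longleftrightarrow> uniform_limit (inner_polydisc l R) (\<lambda>N. partial v j (F N)) g sequentially" for R
    by (intro uniform_limit_cong') (auto simp: inner_polydisc_def)
  then show "converges_inside l (\<lambda>N. partial v j (F N)) (partial v j f)"
    using g unfolding converges_inside_def by blast
qed

text \<open>The key closure property. The interior estimates, applied to differences of members of the
  sequence, make all partial derivatives up to order two locally uniformly Cauchy; hence the limit is
  of class \<open>C\<^sup>2\<close>, its derivatives are the limits of the derivatives, and the equations pass to the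
  limit pointwise.\<close>

lemma sh_uniform_limit:
  assumes w: "\<And>N. w N \<in> sh l a b" and f: "uniform_limit (polydisc l) w f sequentially"
  shows "f \<in> sh l a b"
proof -
  have C: "C_polydisc (Suc (Suc 0)) l (w N)" for N
    using w[of N] by (simp add: sh_def numeral_2_eq_2 del: C_polydisc.simps)
  have cauchy: "uniformly_Cauchy_on (polydisc l) w"
    using f by (intro uniformly_convergent_Cauchy uniformly_convergentI)
  have "uniform_limit (inner_polydisc l R) w f sequentially" for R
    by (rule uniform_limit_on_subset[OF f]) (auto simp: inner_polydisc_def)
  then have c0: "converges_inside l w f" by (simp add: converges_inside_def)
  have cauchy_partials: "uniformly_Cauchy_on (inner_polydisc l R) (\<lambda>N. partial v i (w N))"
      "uniformly_Cauchy_on (inner_polydisc l R) (\<lambda>N. partial v' j (partial v i (w N)))"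
    if R: "0 \<le> R" "R < 1" and i: "i \<in> {1..l}" and j: "j \<in> {1..l}" and v: "v \<in> {1, \<i>}" "v' \<in> {1, \<i>}"
    for R i j v v'
  proof -
    obtain C where C0: "0 \<le> C" and C: "\<And>u u' B i j v v' z. u \<in> sh l a b \<Longrightarrow> u' \<in> sh l a b \<Longrightarrow>
       (\<And>z. z \<in> polydisc l \<Longrightarrow> norm (u z - u' z) \<le> B) \<Longrightarrow>
       i \<in> {1..l} \<Longrightarrow> j \<in> {1..l} \<Longrightarrow> v \<in> {1, \<i>} \<Longrightarrow> v' \<in> {1, \<i>} \<Longrightarrow> z \<in> inner_polydisc l R \<Longrightarrow>
        norm (partial v i u z - partial v i u' z) \<le> C * B \<and>
        norm (partial v' j (partial v i u) z - partial v' j (partial v i u') z) \<le> C * B"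
      by (rule second_order_bound[OF R, of l a b]) blast
    have ex: "\<exists>M. \<forall>x\<in>inner_polydisc l R. \<forall>m\<ge>M. \<forall>n\<ge>M. dist (partial v i (w m) x) (partial v i (w n) x) < e \<and>
        dist (partial v' j (partial v i (w m)) x) (partial v' j (partial v i (w n)) x) < e" if e: "e > 0" for e
    proof -
      define B where "B = e / (C + 1)"
      have B: "0 < B" "C * B < e" using e C0 by (auto simp: B_def field_simps)
      obtain M where M: "\<And>x m n. x \<in> polydisc l \<Longrightarrow> m \<ge> M \<Longrightarrow> n \<ge> M \<Longrightarrow> dist (w m x) (w n x) < B"
        using cauchy B(1) unfolding uniformly_Cauchy_on_def by meson
      show ?thesis
      proof (intro exI[of _ M] ballI allI impI)
        fix x m n assume x: "x \<in> inner_polydisc l R" and mn: "M \<le> m" "M \<le> n"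
        have "norm (w m z - w n z) \<le> B" if "z \<in> polydisc l" for z
          using M[OF that mn] by (simp add: dist_norm)
        from C[OF w w this i j v x] B(2)
        show "dist (partial v i (w m) x) (partial v i (w n) x) < e \<and>
        dist (partial v' j (partial v i (w m)) x) (partial v' j (partial v i (w n)) x) < e"
          unfolding dist_norm by linarith
      qed
    qed
    show "uniformly_Cauchy_on (inner_polydisc l R) (\<lambda>N. partial v i (w N))"
      "uniformly_Cauchy_on (inner_polydisc l R) (\<lambda>N. partial v' j (partial v i (w N)))"
      unfolding uniformly_Cauchy_on_def using ex by meson+
  qed
  have p1: "slice v i f z differentiable at 0" if i: "i \<in> {1..l}" and v: "v \<in> {1, \<i>}" and z: "z \<in> polydisc l" for i v z
    by (rule partial_of_limit(1)[OF c0 C_polydisc_SucD(2)[OF C i v] cauchy_partials(1)[OF _ _ i i v v] i v z])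
  have p1': "converges_inside l (\<lambda>N. partial v i (w N)) (partial v i f)"
    if i: "i \<in> {1..l}" and v: "v \<in> {1, \<i>}" for i v
    by (rule partial_of_limit(2)[OF c0 C_polydisc_SucD(2)[OF C i v] cauchy_partials(1)[OF _ _ i i v v] i v])
  have p2: "slice v' j (partial v i f) z differentiable at 0"
    if i: "i \<in> {1..l}" and v: "v \<in> {1, \<i>}" and j: "j \<in> {1..l}" and v': "v' \<in> {1, \<i>}" and z: "z \<in> polydisc l"
    for i v j v' z
    by (rule partial_of_limit(1)[OF p1'[OF i v] C_polydisc_SucD(2)[OF C_polydisc_SucD(1)[OF C i v] j v']
          cauchy_partials(2)[OF _ _ i j v v'] j v' z])
  have p2': "converges_inside l (\<lambda>N. partial v' j (partial v i (w N))) (partial v' j (partial v i f))"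
    if i: "i \<in> {1..l}" and v: "v \<in> {1, \<i>}" and j: "j \<in> {1..l}" and v': "v' \<in> {1, \<i>}" for i v j v'
    by (rule partial_of_limit(2)[OF p1'[OF i v] C_polydisc_SucD(2)[OF C_polydisc_SucD(1)[OF C i v] j v']
          cauchy_partials(2)[OF _ _ i j v v'] j v'])
  have cont1: "continuous_on (polydisc l) (partial v i f)" if "i \<in> {1..l}" "v \<in> {1, \<i>}" for i v
    by (rule converges_inside_continuous[OF p1'[OF that]])
       (rule C_polydisc_continuous[OF C_polydisc_SucD(1)[OF C that]])
  have cont2: "continuous_on (polydisc l) (partial v' j (partial v i f))"
    if "i \<in> {1..l}" "v \<in> {1, \<i>}" "j \<in> {1..l}" "v' \<in> {1, \<i>}" for i v j v'
    by (rule converges_inside_continuous[OF p2'[OF that]])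
       (rule C_polydisc_continuous[OF C_polydisc_SucD(1)[OF C_polydisc_SucD(1)[OF C that(1,2)] that(3,4)]])
  have cont0: "continuous_on (polydisc l) f"
    by (rule converges_inside_continuous[OF c0 C_polydisc_continuous[OF C]])
  have Cf: "C_polydisc 2 l f"
    unfolding numeral_2_eq_2 C_polydisc.simps
    by (intro conjI ballI cont0 cont1 cont2 p1 p2)
  have "L_op (a j) (b j) j f z = 0" if j: "j \<in> {1..l}" and z: "z \<in> polydisc l" for j z
  proof -
    have l1: "(\<lambda>N. partial v j (w N) z) \<longlonglongrightarrow> partial v j f z" if "v \<in> {1, \<i>}" for v
      by (rule converges_inside_pointwise[OF p1'[OF j that] z])
    have l2: "(\<lambda>N. partial v' j (partial v j (w N)) z) \<longlonglongrightarrow> partial v' j (partial v j f) z"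
      if "v \<in> {1, \<i>}" "v' \<in> {1, \<i>}" for v v'
      by (rule converges_inside_pointwise[OF p2'[OF j that(1) j that(2)] z])
    have ld: "(\<lambda>N. dz j (w N) z) \<longlonglongrightarrow> dz j f z" "(\<lambda>N. dzbar j (w N) z) \<longlonglongrightarrow> dzbar j f z"
      unfolding dz_def dzbar_def by (intro tendsto_intros l1; simp)+
    have ldd: "(\<lambda>N. dz j (dzbar j (w N)) z) \<longlonglongrightarrow> dz j (dzbar j f) z"
      unfolding C_polydisc_second_derivatives(7)[OF C[folded numeral_2_eq_2] j z] C_polydisc_second_derivatives(7)[OF Cf j z]
      by (intro tendsto_intros l2) auto
    have "(\<lambda>N. L_op (a j) (b j) j (w N) z) \<longlonglongrightarrow> L_op (a j) (b j) j f z"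
      unfolding L_op_def by (intro tendsto_intros ld ldd converges_inside_pointwise[OF c0 z])
    moreover have "L_op (a j) (b j) j (w N) z = 0" for N
      using w[of N] j z by (simp add: sh_def)
    ultimately show ?thesis by (simp add: LIMSEQ_const_iff)
  qed
  with Cf show ?thesis by (simp add: sh_def)
qed

section \<open>Passing to the boundary\<close>

definition append_coords :: "nat \<Rightarrow> nat \<Rightarrow> (nat \<Rightarrow> complex) \<Rightarrow> (nat \<Rightarrow> complex) \<Rightarrow> nat \<Rightarrow> complex"
  where "append_coords k n c z = (\<lambda>j\<in>{1..n}. if j \<le> k then z j else c j)"

lemma append_coords_upd:
  assumes "k \<le> n" "j \<in> {1..k}"
  shows "append_coords k n c (z(j := x)) = (append_coords k n c z)(j := x)"
    and "append_coords k n c z j = z j"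
  using assms by (auto simp: append_coords_def fun_eq_iff)

lemma append_coords_polydisc:
  assumes "\<And>j. j \<in> {k<..n} \<Longrightarrow> c j \<in> ball 0 1" "z \<in> polydisc k"
  shows "append_coords k n c z \<in> polydisc n"
  using assms unfolding polydisc_def append_coords_def PiE_iff by auto

lemma append_coords_closed_polydisc:
  assumes "\<And>j. j \<in> {k<..n} \<Longrightarrow> c j \<in> cball 0 1" "z \<in> closed_polydisc k"
  shows "append_coords k n c z \<in> closed_polydisc n"
  using assms unfolding closed_polydisc_def append_coords_def PiE_iff by auto

lemma continuous_on_append_coords:
  fixes f g :: "'a::topological_space \<Rightarrow> nat \<Rightarrow> complex"
  assumes "continuous_on S f" "continuous_on S g"
  shows "continuous_on S (\<lambda>x. append_coords k n (g x) (f x))"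
proof (rule continuous_on_coordinatewise_then_product)
  fix i
  have "continuous_on S (\<lambda>x. f x i)" "continuous_on S (\<lambda>x. g x i)"
    using assms by (auto intro: continuous_on_product_then_coordinatewise)
  then show "continuous_on S (\<lambda>x. append_coords k n (g x) (f x) i)"
    unfolding append_coords_def by (cases "i \<in> {1..n}"; cases "i \<le> k") auto
qed

lemma partial_append_coords:
  assumes "k \<le> n" "j \<in> {1..k}"
  shows "slice v j (\<lambda>z. u (append_coords k n c z)) z = slice v j u (append_coords k n c z)"
    and "partial v j (\<lambda>z. u (append_coords k n c z)) = (\<lambda>z. partial v j u (append_coords k n c z))"
    and "dz j (\<lambda>z. u (append_coords k n c z)) = (\<lambda>z. dz j u (append_coords k n c z))"
    and "dzbar j (\<lambda>z. u (append_coords k n c z)) = (\<lambda>z. dzbar j u (append_coords k n c z))"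
proof -
  show s: "slice v j (\<lambda>z. u (append_coords k n c z)) z = slice v j u (append_coords k n c z)" for v z
    by (simp only: slice_def append_coords_upd[OF assms])
  show "partial v j (\<lambda>z. u (append_coords k n c z)) = (\<lambda>z. partial v j u (append_coords k n c z))" for v
    by (simp add: partial_def s fun_eq_iff)
  then show "dz j (\<lambda>z. u (append_coords k n c z)) = (\<lambda>z. dz j u (append_coords k n c z))"
    "dzbar j (\<lambda>z. u (append_coords k n c z)) = (\<lambda>z. dzbar j u (append_coords k n c z))"
    by (simp_all add: dz_def dzbar_def fun_eq_iff)
qed

lemma C_polydisc_append_coords:
  assumes "C_polydisc m n u" and k: "k \<le> n" and c: "\<And>j. j \<in> {k<..n} \<Longrightarrow> c j \<in> ball 0 1"
  shows "C_polydisc m k (\<lambda>z. u (append_coords k n c z))"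
  using assms(1)
proof (induction m arbitrary: u)
  have cont: "continuous_on (polydisc k) (\<lambda>z. u (append_coords k n c z))" if "continuous_on (polydisc n) u" for u :: "_ \<Rightarrow> complex"
    by (rule continuous_on_compose2[OF that continuous_on_append_coords])
       (use append_coords_polydisc[OF c] in \<open>auto intro: continuous_on_id\<close>)
  {
    case 0
    then show ?case by (simp add: cont)
  next
    case (Suc m)
    have "slice v j (\<lambda>z. u (append_coords k n c z)) z differentiable at 0 \<and>
       C_polydisc m k (partial v j (\<lambda>z. u (append_coords k n c z)))"
      if j: "j \<in> {1..k}" and v: "v \<in> {1, \<i>}" and z: "z \<in> polydisc k" for j v z
    proof -
      have jn: "j \<in> {1..n}" using j k by auto
      have "slice v j u (append_coords k n c z) differentiable at 0"
        using C_polydisc_SucD(2)[OF Suc.prems jn v append_coords_polydisc[OF c z]] by (rule differentiableI_vector)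
      then show ?thesis
        unfolding partial_append_coords[OF k j] using Suc.IH[OF C_polydisc_SucD(1)[OF Suc.prems jn v]] by blast
    qed
    \<comment> \<open>the polydisc is nonempty, so the second conjunct holds unconditionally\<close>
    moreover have "restrict (\<lambda>_. 0) {1..k} \<in> polydisc k"
      by (simp add: polydisc_def)
    ultimately show ?case
      unfolding C_polydisc.simps using cont[OF C_polydisc_continuous[OF Suc.prems]] by blast
  }
qed

text \<open>Freezing variables at interior points preserves the equations in the remaining variables.\<close>

lemma sh_append_coords:
  assumes u: "u \<in> sh n a b" and k: "k \<le> n" and c: "\<And>j. j \<in> {k<..n} \<Longrightarrow> c j \<in> ball 0 1"
  shows "(\<lambda>z. u (append_coords k n c z)) \<in> sh k (restrict a {1..k}) (restrict b {1..k})"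
proof -
  have "L_op (restrict a {1..k} j) (restrict b {1..k} j) j (\<lambda>z. u (append_coords k n c z)) z = 0"
    if j: "j \<in> {1..k}" and z: "z \<in> polydisc k" for j z
  proof -
    have "L_op (a j) (b j) j u (append_coords k n c z) = 0"
      using u j k append_coords_polydisc[OF c z] by (simp add: sh_def)
    then show ?thesis
      using j unfolding L_op_def partial_append_coords[OF k j]
      by (simp add: append_coords_upd(2)[OF k j])
  qed
  moreover have "C_polydisc 2 k (\<lambda>z. u (append_coords k n c z))"
    using u by (intro C_polydisc_append_coords[OF _ k c]) (simp_all add: sh_def)
  ultimately show ?thesis by (simp add: sh_def)
qed

lemma compact_closed_polydisc: "compact (closed_polydisc l)"
proof -
  have "closed_polydisc l = (\<Pi>\<^sub>E i\<in>UNIV. if i \<in> {1..l} then cball 0 1 else {undefined})"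
    unfolding closed_polydisc_def by (auto simp: PiE_iff extensional_def split: if_splits)
  moreover have "compactin (product_topology (\<lambda>_. euclidean) UNIV)
      (\<Pi>\<^sub>E i\<in>UNIV. if i \<in> {1..l} then cball (0::complex) 1 else {undefined})"
    unfolding compactin_PiE by simp
  ultimately show ?thesis
    by (simp add: euclidean_product_topology)
qed

lemma polydisc_subset_closed: "polydisc l \<subseteq> closed_polydisc l"
  unfolding polydisc_def closed_polydisc_def by (intro PiE_mono ball_subset_cball)

text \<open>Uniform continuity on the compact set of all pairs of a radius in \<open>[0, 1]\<close> and a point of the closed
  polydisc.\<close>

lemma radial_uniform_limit:
  assumes u: "continuous_on (closed_polydisc n) u" and \<zeta>: "\<And>j. j \<in> {k<..n} \<Longrightarrow> \<zeta> j \<in> cball 0 1"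
    and t: "\<And>N. t N \<in> {0..1}" "t \<longlonglongrightarrow> 1"
  shows "uniform_limit (closed_polydisc k) (\<lambda>N z. u (append_coords k n (\<lambda>j. of_real (t N) * \<zeta> j) z))
     (\<lambda>z. u (append_coords k n \<zeta> z)) sequentially"
proof (rule uniform_limitI)
  fix e :: real assume e: "0 < e"
  let ?H = "\<lambda>(s, z). u (append_coords k n (\<lambda>j. of_real s * \<zeta> j) z)"
  let ?S = "{0..1} \<times> closed_polydisc k"
  have "continuous_on ?S ?H"
    unfolding case_prod_beta
  proof (rule continuous_on_compose2[OF u continuous_on_append_coords])
    show "continuous_on ?S snd" by (intro continuous_intros)
    show "continuous_on ?S (\<lambda>p j. of_real (fst p) * \<zeta> j)"
      by (intro continuous_on_coordinatewise_then_product continuous_intros)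
    show "(\<lambda>p. append_coords k n (\<lambda>j. of_real (fst p) * \<zeta> j) (snd p)) ` ?S \<subseteq> closed_polydisc n"
      using \<zeta> by (auto intro!: append_coords_closed_polydisc mult_le_one simp: norm_mult)
  qed
  then have "uniformly_continuous_on ?S ?H"
    by (intro compact_uniformly_continuous compact_Times compact_closed_polydisc) auto
  then obtain d where d: "0 < d" and H: "\<And>p q. p \<in> ?S \<Longrightarrow> q \<in> ?S \<Longrightarrow> dist q p < d \<Longrightarrow> dist (?H q) (?H p) < e"
    using e unfolding uniformly_continuous_on_def by metis
  have "\<forall>\<^sub>F N in sequentially. dist (t N) 1 < d"
    using t(2) d by (rule tendstoD)
  then show "\<forall>\<^sub>F N in sequentially. \<forall>z\<in>closed_polydisc k.
      dist (u (append_coords k n (\<lambda>j. of_real (t N) * \<zeta> j) z)) (u (append_coords k n \<zeta> z)) < e"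
  proof (rule eventually_mono, intro ballI)
    fix N z assume "dist (t N) 1 < d" "z \<in> closed_polydisc k"
    then show "dist (u (append_coords k n (\<lambda>j. of_real (t N) * \<zeta> j) z)) (u (append_coords k n \<zeta> z)) < e"
      using H[of "(1, z)" "(t N, z)"] t(1)[of N] by (simp add: dist_Pair_Pair)
  qed
qed

theorem lemma3p3:
  fixes n k :: nat
    and \<alpha> \<beta> \<zeta> :: "nat \<Rightarrow> complex"
    and u :: "(nat \<Rightarrow> complex) \<Rightarrow> complex"
  assumes "\<And>j. j \<in> {1..n} \<Longrightarrow> Re (\<alpha> j) + Re (\<beta> j) > -1"
    and "\<And>j. j \<in> {1..n} \<Longrightarrow> \<alpha> j \<notin> {- of_nat m | m. 1 \<le> m}"
    and "\<And>j. j \<in> {1..n} \<Longrightarrow> \<beta> j \<notin> {- of_nat m | m. 1 \<le> m}"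
    and "u \<in> Csh n \<alpha> \<beta>"
    and "1 \<le> k" and "k < n"
    and "\<And>j. j \<in> {k<..n} \<Longrightarrow> \<zeta> j \<in> sphere 0 1"
  shows "(\<lambda>z. u (\<lambda>j\<in>{1..n}. if j \<le> k then z j else \<zeta> j))
           \<in> Csh k (restrict \<alpha> {1..k}) (restrict \<beta> {1..k})"
proof -
  have u: "u \<in> sh n \<alpha> \<beta>" and uc: "continuous_on (closed_polydisc n) u"
    using assms(4) by (auto simp: Csh_def)
  have \<zeta>: "\<zeta> j \<in> cball 0 1" if "j \<in> {k<..n}" for j
    using assms(7)[OF that] by simp
  define t where "t N = real (Suc N) / real (Suc (Suc N))" for N
  have t: "0 \<le> t N" "t N < 1" for N by (auto simp: t_def)
  have t1: "t \<longlonglongrightarrow> 1"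
    unfolding t_def using LIMSEQ_ignore_initial_segment[OF LIMSEQ_n_over_Suc_n, of 1] by simp
  define w where "w = (\<lambda>N z. u (append_coords k n (\<lambda>j. of_real (t N) * \<zeta> j) z))"
  have "w N \<in> sh k (restrict \<alpha> {1..k}) (restrict \<beta> {1..k})" for N
    unfolding w_def
  proof (rule sh_append_coords[OF u])
    show "of_real (t N) * \<zeta> j \<in> ball 0 1" if "j \<in> {k<..n}" for j
      using t[of N] assms(7)[OF that] by (simp add: norm_mult)
  qed (use assms(6) in simp)
  moreover have "uniform_limit (polydisc k) w (\<lambda>z. u (append_coords k n \<zeta> z)) sequentially"
    unfolding w_def
    by (rule uniform_limit_on_subset[OF radial_uniform_limit[OF uc \<zeta> _ t1] polydisc_subset_closed])
       (use t in \<open>auto intro: less_imp_le\<close>)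
  ultimately have "(\<lambda>z. u (append_coords k n \<zeta> z)) \<in> sh k (restrict \<alpha> {1..k}) (restrict \<beta> {1..k})"
    by (rule sh_uniform_limit)
  moreover have "continuous_on (closed_polydisc k) (\<lambda>z. u (append_coords k n \<zeta> z))"
    by (rule continuous_on_compose2[OF uc continuous_on_append_coords])
       (use append_coords_closed_polydisc[OF \<zeta>] in \<open>auto intro: continuous_on_id\<close>)
  ultimately show ?thesis
    unfolding Csh_def append_coords_def by simp
qed

end
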